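(* For every $m \in \mathbb{N}$ there exists a linkage $P = (l_1, \dots, l_n)$ (for some $n$, with all $l_i > 0$) such that for all integers $k$ with $0 \le k \le m$ the homology group $H_k\bigl(\overline{M^o(P)}\bigr)$ is non-trivial (i.e. is not the zero group). Here $\overline{M^o(P)}$ is the closure, in the planar configuration space $M(P)$ of $P$, of the subset $M^o(P)$ of configurations without self-intersections.
   Context: An $n$-linkage is a finite sequence $P = (l_1, \dots, l_n)$ of positive real numbers, interpreted as rigid bars of lengths $l_i$ joined consecutively by revolving joints in a closed chain. A (planar) configuration of $P$ is a sequence of points $R = (a_1, \dots, a_n)$, $a_i \in \mathbb{R}^2$, with $|a_i - a_{i+1}| = l_i$ for all $i = 1, \dots, n$, where indices are cyclic, so $a_{n+1} = a_1$. The configuration space $M(P)$ is the set of all planar configurations of $P$ (self-intersections are allowed) modulo the action of all isometries of $\mathbb{R}^2$. It carries the quotient topology of the subspace topology inherited from $(\mathbb{R}^2)^n$. The subset $M^o(P) \subset M(P)$ consists of the classes of configurations without self-intersections, i.e. those for which the closed polygon with edges $[a_i, a_{i+1}]$ is simple: non-consecutive edges are disjoint and consecutive edges meet only at their common vertex. $\overline{M^o(P)}$ denotes the closure of $M^o(P)$ in $M(P)$, and $H_k$ denotes singular homology with integer coefficients. *)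

theory Defs
  imports "HOL-Analysis.Analysis" "HOL-Homology.Homology"
begin

(* Vertices and edges are numbered 0, ..., n - 1 instead of 1, ..., n; edge i joins vertex i to
   vertex (i + 1) mod n. *)

definition linkage :: "real list \<Rightarrow> bool" where
  "linkage P \<longleftrightarrow> P \<noteq> [] \<and> (\<forall>l\<in>set P. 0 < l)"

definition next_index :: "real list \<Rightarrow> nat \<Rightarrow> nat" where
  "next_index P i = (i + 1) mod length P"

(* (R^2)^n is represented by the extensional functions on {..<n}, with the product topology. *)

definition plane_power :: "nat \<Rightarrow> (nat \<Rightarrow> real^2) topology" where
  "plane_power n = product_topology (\<lambda>_. euclidean) {..<n}"

definition configurations :: "real list \<Rightarrow> (nat \<Rightarrow> real^2) set" where
  "configurations P =
    {a \<in> topspace (plane_power (length P)).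
      \<forall>i<length P. dist (a i) (a (next_index P i)) = P ! i}"

definition plane_isometry :: "(real^2 \<Rightarrow> real^2) \<Rightarrow> bool" where
  "plane_isometry f \<longleftrightarrow> bij f \<and> (\<forall>x y. dist (f x) (f y) = dist x y)"

definition congruence :: "real list \<Rightarrow> ((nat \<Rightarrow> real^2) \<times> (nat \<Rightarrow> real^2)) set" where
  "congruence P =
    {(a, b). a \<in> configurations P \<and> b \<in> configurations P \<and>
      (\<exists>f. plane_isometry f \<and> (\<forall>i<length P. b i = f (a i)))}"

definition quotient_topology :: "'a topology \<Rightarrow> ('a \<times> 'a) set \<Rightarrow> 'a set topology" where
  "quotient_topology X r =
    topology (\<lambda>U. U \<subseteq> topspace X // r \<and> openin X {x \<in> topspace X. r `` {x} \<in> U})"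

definition configuration_space :: "real list \<Rightarrow> (nat \<Rightarrow> real^2) set topology" where
  "configuration_space P =
    quotient_topology (subtopology (plane_power (length P)) (configurations P)) (congruence P)"

definition edge :: "real list \<Rightarrow> (nat \<Rightarrow> real^2) \<Rightarrow> nat \<Rightarrow> (real^2) set" where
  "edge P a i = closed_segment (a i) (a (next_index P i))"

definition self_intersection_free :: "real list \<Rightarrow> (nat \<Rightarrow> real^2) \<Rightarrow> bool" where
  "self_intersection_free P a \<longleftrightarrow>
    (\<forall>i<length P. edge P a i \<inter> edge P a (next_index P i) = {a (next_index P i)}) \<and>
    (\<forall>i<length P. \<forall>j<length P.
      i \<noteq> j \<and> j \<noteq> next_index P i \<and> i \<noteq> next_index P j \<longrightarrow> edge P a i \<inter> edge P a j = {})"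

definition simple_classes :: "real list \<Rightarrow> (nat \<Rightarrow> real^2) set set" where
  "simple_classes P = {a \<in> configurations P. self_intersection_free P a} // congruence P"

definition closure_simple_space :: "real list \<Rightarrow> (nat \<Rightarrow> real^2) set topology" where
  "closure_simple_space P =
    subtopology (configuration_space P) (configuration_space P closure_of simple_classes P)"

lemma equiv_congruence: "equiv (configurations P) (congruence P)"
proof (rule equivI)
  show "congruence P \<subseteq> configurations P \<times> configurations P"
    by (auto simp: congruence_def)
  have "plane_isometry id"
    by (simp add: plane_isometry_def)
  then show "refl_on (configurations P) (congruence P)"
    by (force simp: refl_on_def congruence_def)
  show "sym (congruence P)"
  proof (rule symI)
    fix a b assume ab: "(a, b) \<in> congruence P"
    then obtain f where f: "plane_isometry f" and fi: "\<forall>i<length P. b i = f (a i)"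
      by (auto simp: congruence_def)
    have bij: "bij f" and d: "\<And>x y. dist (f x) (f y) = dist x y"
      using f by (auto simp: plane_isometry_def)
    have "dist (inv_into UNIV f x) (inv_into UNIV f y) = dist x y" for x y
      using d[of "inv_into UNIV f x" "inv_into UNIV f y"] bij by (simp add: bij_is_surj surj_f_inv_f)
    then have "plane_isometry (inv_into UNIV f)"
      using bij by (simp add: plane_isometry_def bij_imp_bij_inv)
    moreover have "\<forall>i<length P. a i = inv_into UNIV f (b i)"
      using fi bij by (simp add: bij_is_inj)
    ultimately show "(b, a) \<in> congruence P"
      using ab by (auto simp: congruence_def)
  qed
  show "trans (congruence P)"
  proof (rule transI)
    fix a b c assume ab: "(a, b) \<in> congruence P" and bc: "(b, c) \<in> congruence P"
    obtain f where f: "plane_isometry f" "\<forall>i<length P. b i = f (a i)"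
      using ab by (auto simp: congruence_def)
    obtain g where g: "plane_isometry g" "\<forall>i<length P. c i = g (b i)"
      using bc by (auto simp: congruence_def)
    have "plane_isometry (g \<circ> f)"
      using f(1) g(1) by (auto simp: plane_isometry_def intro: bij_comp)
    moreover have "\<forall>i<length P. c i = (g \<circ> f) (a i)"
      using f(2) g(2) by simp
    ultimately show "(a, c) \<in> congruence P"
      using ab bc unfolding congruence_def by blast
  qed
qed

lemma openin_quotient_topology:
  "openin (quotient_topology X r) U \<longleftrightarrow>
    U \<subseteq> topspace X // r \<and> openin X {x \<in> topspace X. r `` {x} \<in> U}"
proof -
  have "istopology (\<lambda>U. U \<subseteq> topspace X // r \<and> openin X {x \<in> topspace X. r `` {x} \<in> U})"
    unfolding istopology_def
  proof (intro conjI allI impI; (elim conjE)?)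
    fix S T
    assume S: "openin X {x \<in> topspace X. r `` {x} \<in> S}" and T: "openin X {x \<in> topspace X. r `` {x} \<in> T}"
    have "{x \<in> topspace X. r `` {x} \<in> S \<inter> T} =
        {x \<in> topspace X. r `` {x} \<in> S} \<inter> {x \<in> topspace X. r `` {x} \<in> T}"
      by auto
    then show "openin X {x \<in> topspace X. r `` {x} \<in> S \<inter> T}"
      using S T by (simp add: openin_Int)
  next
    fix \<K>
    assume K: "\<forall>K\<in>\<K>. K \<subseteq> topspace X // r \<and> openin X {x \<in> topspace X. r `` {x} \<in> K}"
    have "{x \<in> topspace X. r `` {x} \<in> \<Union>\<K>} = (\<Union>K\<in>\<K>. {x \<in> topspace X. r `` {x} \<in> K})"
      by auto
    then show "openin X {x \<in> topspace X. r `` {x} \<in> \<Union>\<K>}"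
      using K by auto
  qed (blast+)
  then show ?thesis
    by (simp add: quotient_topology_def topology_inverse')
qed

lemma topspace_quotient_topology: "topspace (quotient_topology X r) = topspace X // r"
proof
  show "topspace (quotient_topology X r) \<subseteq> topspace X // r"
    using openin_quotient_topology openin_topspace by blast
  have "{x \<in> topspace X. r `` {x} \<in> topspace X // r} = topspace X"
    by (auto intro: quotientI)
  then have "openin (quotient_topology X r) (topspace X // r)"
    by (simp add: openin_quotient_topology)
  then show "topspace X // r \<subseteq> topspace (quotient_topology X r)"
    by (rule openin_subset)
qed

lemma quotient_map_quotient_topology:
  "quotient_map X (quotient_topology X r) (\<lambda>x. r `` {x})"
  by (auto simp: quotient_map_def topspace_quotient_topology openin_quotient_topology quotient_def)

end

theory Submission
  imports Defs
begin

text \<open>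
  Take two long bars \<open>AB\<close>, \<open>BC\<close> closing up an almost equilateral triangle
  with vertices \<open>A\<close>, \<open>B\<close>, \<open>C\<close>, and let the chain from \<open>C\<close> to \<open>A\<close> consist of a long
  bar followed by \<open>m\<close> unit bars, each followed by a bar of length 4. Keeping all the other bars of
  the chain horizontal, the unit bars may point in arbitrary directions; this gives a map from
  the torus \<open>T\<^sup>m\<close> to the configuration space. The polygon is simple as soon as no unit bar
  is horizontal, so by density the image lies in the closure of the simple classes. The angles between
  the first bar of the chain and the unit bars, oriented by the nondegenerate triangle \<open>ABC\<close>,
  are invariant under isometries and provide a continuous left inverse. Hence \<open>H\<^sub>k(T\<^sup>m)\<close>
  embeds into the homology of the closure, and it is nontrivial for \<open>k \<le> m\<close>: if \<open>c \<noteq> 0\<close> in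
  \<open>H\<^sub>p(X)\<close> with \<open>p \<ge> 1\<close>, then the difference of the copies of \<open>c\<close> over two points of
  the circle bounds over either of the two arcs, and gluing the two chains gives a nonzero class in
  \<open>H\<close> of \<open>X \<times> S\<^sup>1\<close> in degree \<open>p + 1\<close>.
\<close>

section \<open>Homology of tori\<close>

lemma trivial_homology_group_iff:
  "trivial_group (homology_group p X) \<longleftrightarrow> carrier (homology_group p X) \<subseteq> {\<one>\<^bsub>homology_group p X\<^esub>}"
  using monoid.one_closed[OF group.is_monoid[OF group_relative_homology_group[of p X "{}"]]]
  by (auto simp: trivial_group_def)

text \<open>By functoriality a continuous left inverse makes the induced map injective, so a nonzero
  class keeps a nonzero image. Every transfer of nontriviality between spaces below goes through
  this.\<close>

lemma nontrivial_homology_group_section: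
  assumes f: "continuous_map X Y f" and g: "continuous_map Y X g"
    and gf: "\<And>x. x \<in> topspace X \<Longrightarrow> g (f x) = x"
    and X: "\<not> trivial_group (homology_group p X)"
  shows "\<not> trivial_group (homology_group p Y)"
proof
  assume Y: "trivial_group (homology_group p Y)"
  have "section_map X Y f"
    using f g gf by (auto simp: section_map_def retraction_maps_def)
  then have "inj_on (hom_induced p X {} Y {} f) (carrier (homology_group p X))"
    by (rule inj_on_hom_induced_section_map)
  moreover have "hom_induced p X {} Y {} f c = \<one>\<^bsub>homology_group p Y\<^esub>" for c
    using Y hom_induced_carrier[of p X "{}" Y "{}" f c] by (auto simp: trivial_group_def)
  ultimately have "c = \<one>\<^bsub>homology_group p X\<^esub>" if "c \<in> carrier (homology_group p X)" for c
    using that by (auto dest: inj_onD[where y = "\<one>\<^bsub>homology_group p X\<^esub>"] simp: group.is_monoid)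
  then show False
    using X by (simp add: trivial_homology_group_iff subset_iff)
qed

text \<open>The homotopy slides the slice along the path. The target is only the part over
  \<open>D\<close>, so that the two slices become homologous over each arc separately.\<close>

lemma homotopic_with_prod_path:
  assumes "pathin (subtopology K D) g"
  shows "homotopic_with (\<lambda>h. True) X (subtopology (prod_topology X K) (topspace X \<times> D))
    (\<lambda>x. (x, g 0)) (\<lambda>x. (x, g 1))"
proof -
  let ?I = "top_of_set {0..1::real}"
  have g: "continuous_map ?I K g" "\<And>t. t \<in> {0..1} \<Longrightarrow> g t \<in> D"
    using assms by (auto simp: pathin_def continuous_map_in_subtopology Pi_iff)
  have "continuous_map (prod_topology ?I X) K (g \<circ> fst)"
    by (rule continuous_map_compose[OF continuous_map_fst g(1)])
  then have "continuous_map (prod_topology ?I X) (prod_topology X K) (\<lambda>(t, x). (x, g t))"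
    by (auto simp: continuous_map_pairwise o_def case_prod_unfold continuous_map_snd)
  then show ?thesis
    unfolding homotopic_with_def
    by (intro exI[of _ "\<lambda>(t, x). (x, g t)"])
       (auto simp: continuous_map_in_subtopology Pi_iff g(2))
qed

text \<open>A constant map factors through a one-point space, whose homology vanishes in nonzero
  degree.\<close>

lemma hom_induced_constant:
  assumes "p \<noteq> 0" "y \<in> topspace Y"
  shows "hom_induced p X {} Y {} (\<lambda>x. y) c = \<one>\<^bsub>homology_group p Y\<^esub>"
proof -
  let ?D = "subtopology Y {y}"
  have D: "topspace ?D = {y}"
    using assms by auto
  have tr: "trivial_group (homology_group p ?D)"
    using homology_dimension_axiom[OF D assms(1)] .
  have c: "continuous_map X ?D (\<lambda>x. y)" "continuous_map ?D Y id"
    using assms by (auto simp: continuous_map_in_subtopology)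
  have "hom_induced p X {} Y {} (\<lambda>x. y) c = hom_induced p ?D {} Y {} id (hom_induced p X {} ?D {} (\<lambda>x. y) c)"
    using c by (simp add: hom_induced_compose' o_def)
  also have "hom_induced p X {} ?D {} (\<lambda>x. y) c = \<one>\<^bsub>homology_group p ?D\<^esub>"
    using tr hom_induced_carrier[of p X "{}" ?D "{}" "\<lambda>x. y" c] by (auto simp: trivial_group_def)
  also have "hom_induced p ?D {} Y {} id \<dots> = \<one>\<^bsub>homology_group p Y\<^esub>"
    by (intro hom_one[OF hom_induced_empty_hom]) auto
  finally show ?thesis .
qed

lemma hom_induced_mult_inv:
  assumes "a \<in> carrier (homology_group p X)" "b \<in> carrier (homology_group p X)"
  shows "hom_induced p X {} Y {} f (a \<otimes>\<^bsub>homology_group p X\<^esub> inv\<^bsub>homology_group p X\<^esub> b)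
    = hom_induced p X {} Y {} f a \<otimes>\<^bsub>homology_group p Y\<^esub> inv\<^bsub>homology_group p Y\<^esub> hom_induced p X {} Y {} f b"
proof -
  interpret group_hom "homology_group p X" "homology_group p Y" "hom_induced p X {} Y {} f"
    by (simp add: group_hom_def group_hom_axioms_def hom_induced_empty_hom)
  show ?thesis
    using assms by simp
qed

text \<open>This is the connecting homomorphism of Mayer-Vietoris, run backwards by hand. The
  difference \<open>d\<close> of two copies of a class lives over \<open>P \<inter> Q\<close>; it is
  nonzero there but dies over \<open>P\<close> and over \<open>Q\<close>. As a boundary over
  \<open>P\<close> it comes from a relative class \<open>e\<close>, which excision moves to a class
  \<open>e'\<close> of the whole product relative to the part over \<open>Q\<close>. The boundary of
  \<open>e'\<close> vanishes, so \<open>e'\<close> lifts to an absolute class, nonzero because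
  \<open>e'\<close> is.\<close>

lemma nontrivial_homology_group_prod_two_arcs:
  fixes X :: "'a topology" and K :: "'b topology"
  assumes PQ: "openin K P" "openin K Q" "P \<union> Q = topspace K"
    and AB: "openin K A" "openin K B" "A \<inter> B = {}" "P \<inter> Q = A \<union> B"
    and ab: "a \<in> A" "b \<in> B"
    and g: "pathin (subtopology K P) g" "g 0 = a" "g 1 = b"
    and h: "pathin (subtopology K Q) h" "h 0 = a" "h 1 = b"
    and p: "p \<noteq> 0"
    and X: "\<not> trivial_group (homology_group p X)"
  shows "\<not> trivial_group (homology_group (p + 1) (prod_topology X K))"
proof -
  define Z where "Z = prod_topology X K"
  define ZP where "ZP = subtopology Z (topspace X \<times> P)"
  define ZQ where "ZQ = subtopology Z (topspace X \<times> Q)"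
  define E where "E = topspace X \<times> (P \<inter> Q)"
  define ZE where "ZE = subtopology Z E"
  have PK: "P \<subseteq> topspace K" "Q \<subseteq> topspace K" "A \<subseteq> topspace K" "B \<subseteq> topspace K"
    using PQ AB openin_subset by auto
  have ZE: "subtopology ZP E = ZE" "subtopology ZQ E = ZE"
    by (auto simp: ZP_def ZQ_def ZE_def E_def subtopology_subtopology Times_Int_Times Int_ac)
  let ?ia = "\<lambda>x. (x, a)" and ?ib = "\<lambda>x. (x, b)"
  obtain c where c: "c \<in> carrier (homology_group p X)" "c \<noteq> \<one>\<^bsub>homology_group p X\<^esub>"
    using X by (auto simp: trivial_homology_group_iff)
  define ca where "ca = hom_induced p X {} ZE {} ?ia c"
  define cb where "cb = hom_induced p X {} ZE {} ?ib c"
  define d where "d = ca \<otimes>\<^bsub>homology_group p ZE\<^esub> inv\<^bsub>homology_group p ZE\<^esub> cb"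
  have cab: "ca \<in> carrier (homology_group p ZE)" "cb \<in> carrier (homology_group p ZE)"
    by (auto simp: ca_def cb_def hom_induced_carrier)
  then have d: "d \<in> carrier (homology_group p ZE)"
    by (simp add: d_def group.inv_closed monoid.m_closed group.is_monoid)
  note dimage = hom_induced_mult_inv[OF cab, folded d_def]
  have i: "continuous_map X ZE ?ia" "continuous_map X ZE ?ib"
    using ab AB PK by (auto simp: ZE_def E_def Z_def continuous_map_in_subtopology continuous_map_pairwise o_def)
  \<comment> \<open>A path from \<open>a\<close> to \<open>b\<close> inside \<open>D\<close> makes
    the two slices homotopic over \<open>D\<close>, so \<open>ca\<close> and \<open>cb\<close> have
    the same image there.\<close>
  have dnull: "hom_induced p ZE {} (subtopology Z (topspace X \<times> D)) {} id d
      = \<one>\<^bsub>homology_group p (subtopology Z (topspace X \<times> D))\<^esub>"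
    if D: "P \<inter> Q \<subseteq> D" and path: "pathin (subtopology K D) u" "u 0 = a" "u 1 = b" for D u
  proof -
    let ?Y = "subtopology Z (topspace X \<times> D)"
    have id: "continuous_map ZE ?Y id"
      using D by (auto simp: ZE_def E_def continuous_map_in_subtopology intro: continuous_map_from_subtopology)
    have "hom_induced p X {} ?Y {} ?ia = hom_induced p X {} ?Y {} ?ib"
      using homotopic_with_prod_path[OF path(1), of X] path
      by (intro homology_homotopy_empty) (simp add: Z_def)
    then have "hom_induced p ZE {} ?Y {} id ca = hom_induced p ZE {} ?Y {} id cb"
      using i id by (simp add: ca_def cb_def hom_induced_compose')
    then show ?thesis
      unfolding dimage
      by (simp add: group.r_inv hom_induced_carrier)
  qed
  have dP: "hom_induced p ZE {} ZP {} id d = \<one>\<^bsub>homology_group p ZP\<^esub>"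
    unfolding ZP_def by (rule dnull[OF _ g]) auto
  have dQ: "hom_induced p ZE {} ZQ {} id d = \<one>\<^bsub>homology_group p ZQ\<^esub>"
    unfolding ZQ_def by (rule dnull[OF _ h]) auto
  have dne: "d \<noteq> \<one>\<^bsub>homology_group p ZE\<^esub>"
  proof
    assume d1: "d = \<one>\<^bsub>homology_group p ZE\<^esub>"
    obtain x0 where x0: "x0 \<in> topspace X"
      using trivial_homology_group_empty[of X p] X by blast
    \<comment> \<open>Collapsing the component over \<^term>\<open>B\<close> to a point kills the second summand of \<^term>\<open>d\<close>;
      this is where \<^prop>\<open>p \<noteq> 0\<close> enters.\<close>
    define r where "r = (\<lambda>z. if snd z \<in> A then fst z else x0)"
    have r: "continuous_map ZE X r"
    proof -
      let ?EA = "topspace X \<times> A" and ?EB = "topspace X \<times> B"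
      have "openin Z ?EA" "openin Z ?EB"
        using AB by (simp_all add: Z_def openin_prod_Times_iff)
      moreover have "?EA = ?EA \<inter> E" "?EB = ?EB \<inter> E"
        using AB by (auto simp: E_def)
      ultimately have op: "openin ZE ?EA" "openin ZE ?EB"
        unfolding ZE_def openin_subtopology by blast+
      have "continuous_map (subtopology ZE ?EA) X r"
        by (rule continuous_map_eq[of _ _ fst])
           (auto simp: r_def ZE_def Z_def intro!: continuous_map_from_subtopology continuous_map_fst)
      moreover have "continuous_map (subtopology ZE ?EB) X r"
      proof (rule continuous_map_eq)
        show "continuous_map (subtopology ZE ?EB) X (\<lambda>_. x0)"
          using x0 by simp
        show "x0 = r z" if "z \<in> topspace (subtopology ZE ?EB)" for z
          using that AB(3) by (auto simp: r_def)
      qed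
      moreover have "topspace ZE \<subseteq> ?EA \<union> ?EB"
        using AB by (auto simp: ZE_def E_def)
      ultimately show ?thesis
        using op by (intro pasting_lemma[of "{?EA, ?EB}" ZE "\<lambda>T. T" X "\<lambda>_. r" r]) auto
    qed
    have "hom_induced p ZE {} X {} r ca = hom_induced p X {} X {} (\<lambda>x. x) c"
      using i r ab by (simp add: ca_def hom_induced_compose' o_def r_def)
    also have "\<dots> = c"
      using c by (simp add: hom_induced_id_gen)
    finally have rca: "hom_induced p ZE {} X {} r ca = c" .
    have "hom_induced p ZE {} X {} r cb = hom_induced p X {} X {} (\<lambda>x. x0) c"
    proof -
      have "b \<notin> A"
        using ab AB(3) by auto
      then show ?thesis
        using i r by (simp add: cb_def hom_induced_compose' o_def r_def)
    qed
    then have rcb: "hom_induced p ZE {} X {} r cb = \<one>\<^bsub>homology_group p X\<^esub>"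
      using hom_induced_constant[OF p x0] by simp
    have "hom_induced p ZE {} X {} r d = c"
      unfolding dimage rca rcb using c
      by (simp add: monoid.inv_one group.is_monoid)
    moreover have "hom_induced p ZE {} X {} r d = \<one>\<^bsub>homology_group p X\<^esub>"
      unfolding d1 by (intro hom_one[OF hom_induced_empty_hom]) auto
    ultimately show False
      using c by simp
  qed
  \<comment> \<open>Exactness of the pair \<open>(ZP, E)\<close>: a class of \<open>E\<close> that
    dies in \<open>ZP\<close> is a boundary.\<close>
  obtain e where e: "e \<in> carrier (relative_homology_group (p + 1) ZP E)" "hom_boundary (p + 1) ZP E e = d"
  proof -
    have "d \<in> kernel (homology_group p ZE) (homology_group p ZP) (hom_induced p ZE {} ZP {} id)"
      using d dP by (simp add: kernel_def)
    also have "\<dots> = hom_boundary (p + 1) ZP E ` carrier (relative_homology_group (p + 1) ZP E)"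
      using homology_exactness_axiom_2[of "p + 1" ZP E] by (simp add: ZE)
    finally show ?thesis
      using that by auto
  qed
  have ene: "e \<noteq> \<one>\<^bsub>relative_homology_group (p + 1) ZP E\<^esub>"
  proof
    assume "e = \<one>\<^bsub>relative_homology_group (p + 1) ZP E\<^esub>"
    then have "d = \<one>\<^bsub>homology_group p (subtopology ZP E)\<^esub>"
      using hom_one[OF hom_boundary_hom[of "p + 1" ZP E]] e by simp
    then show False
      using dne by (simp add: ZE)
  qed
  define T where "T = topspace X \<times> Q"
  define e' where "e' = hom_induced (p + 1) ZP E Z T id e"
  have iso: "hom_induced (p + 1) ZP E Z T id \<in> iso (relative_homology_group (p + 1) ZP E) (relative_homology_group (p + 1) Z T)"
  proof -
    \<comment> \<open>The excised set is the part over the complement of \<open>P\<close>. It is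
      closed and contained in the open set \<open>T\<close>, and removing it leaves the pair
      \<open>(ZP, E)\<close>.\<close>
    let ?U = "topspace X \<times> (topspace K - P)"
    have "closedin Z ?U"
      unfolding Z_def closedin_prod_Times_iff using PQ by blast
    moreover have "openin Z T"
      using PQ by (simp add: Z_def T_def openin_prod_Times_iff)
    moreover have "?U \<subseteq> T"
      using PQ by (auto simp: T_def)
    ultimately have "Z closure_of ?U \<subseteq> Z interior_of T"
      by (simp add: closure_of_closedin interior_of_openin)
    moreover have "T \<subseteq> topspace Z"
      using PK by (auto simp: T_def Z_def)
    moreover have "topspace Z - ?U = topspace X \<times> P" "T - ?U = E"
      using PK by (auto simp: Z_def T_def E_def)
    ultimately show ?thesis
      using homology_excision_axiom[of Z ?U T "topspace Z" "p + 1"] by (simp add: ZP_def)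
  qed
  have e': "e' \<in> carrier (relative_homology_group (p + 1) Z T)"
    by (simp add: e'_def hom_induced_carrier)
  have e'ne: "e' \<noteq> \<one>\<^bsub>relative_homology_group (p + 1) Z T\<^esub>"
  proof
    assume "e' = \<one>\<^bsub>relative_homology_group (p + 1) Z T\<^esub>"
    moreover have "hom_induced (p + 1) ZP E Z T id \<one>\<^bsub>relative_homology_group (p + 1) ZP E\<^esub>
        = \<one>\<^bsub>relative_homology_group (p + 1) Z T\<^esub>"
      by (intro hom_one[OF hom_induced_hom]) auto
    ultimately have "hom_induced (p + 1) ZP E Z T id e
        = hom_induced (p + 1) ZP E Z T id \<one>\<^bsub>relative_homology_group (p + 1) ZP E\<^esub>"
      by (simp add: e'_def)
    moreover have "inj_on (hom_induced (p + 1) ZP E Z T id) (carrier (relative_homology_group (p + 1) ZP E))"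
      using iso by (simp add: iso_def bij_betw_def)
    ultimately have "e = \<one>\<^bsub>relative_homology_group (p + 1) ZP E\<^esub>"
      using e(1) by (auto dest: inj_onD simp: group.is_monoid)
    then show False
      using ene by simp
  qed
  \<comment> \<open>Naturality of the boundary for the inclusion of \<open>(ZP, E)\<close> into
    \<open>(Z, T)\<close> identifies this boundary with the image of \<open>d\<close> over
    \<open>Q\<close>, which is zero by \<open>dQ\<close>.\<close>
  have "hom_boundary (p + 1) Z T e' = hom_induced p ZE {} ZQ {} id d"
  proof -
    have "continuous_map ZP Z id" "id \<in> E \<rightarrow> T"
      by (auto simp: ZP_def E_def T_def intro: continuous_map_from_subtopology)
    from fun_cong[OF naturality_hom_induced[OF this, of "p + 1"], of e] show ?thesis
      by (simp add: e'_def e(2) ZE(1)) (simp add: ZQ_def T_def)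
  qed
  then have "e' \<in> kernel (relative_homology_group (p + 1) Z T) (homology_group p ZQ) (hom_boundary (p + 1) Z T)"
    using e' dQ by (simp add: kernel_def)
  then have "e' \<in> hom_induced (p + 1) Z {} Z T id ` carrier (homology_group (p + 1) Z)"
    using homology_exactness_axiom_1[of "p + 1" Z T] by (simp add: ZQ_def T_def)
  then obtain z where z: "z \<in> carrier (homology_group (p + 1) Z)" "e' = hom_induced (p + 1) Z {} Z T id z"
    by auto
  have "z \<noteq> \<one>\<^bsub>homology_group (p + 1) Z\<^esub>"
  proof
    assume z1: "z = \<one>\<^bsub>homology_group (p + 1) Z\<^esub>"
    have "e' = \<one>\<^bsub>relative_homology_group (p + 1) Z T\<^esub>"
      unfolding z(2) z1 by (intro hom_one[OF hom_induced_hom]) auto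
    then show False
      using e'ne by simp
  qed
  then show ?thesis
    using z(1) by (auto simp: trivial_homology_group_iff Z_def)
qed

text \<open>Any point is a retract of the space, and the zeroth homology of a point is the
  integers.\<close>

lemma nontrivial_homology_group_zero:
  assumes "topspace X \<noteq> {}"
  shows "\<not> trivial_group (homology_group 0 X)"
proof -
  obtain x where x: "x \<in> topspace X"
    using assms by blast
  let ?D = "subtopology X {x}"
  have D: "topspace ?D = {x}"
    using x by auto
  have "\<not> trivial_group integer_group"
    by (rule nontrivial_integer_group)
  then have "\<not> trivial_group (homology_group 0 ?D)"
    using isomorphic_group_triviality[OF homology_coefficients[OF D] group_relative_homology_group group_integer_group]
    by blast
  moreover have "continuous_map ?D X id" "continuous_map X ?D (\<lambda>_. x)"
    using x by (auto simp: continuous_map_in_subtopology)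
  ultimately show ?thesis
    using nontrivial_homology_group_section[of ?D X id "\<lambda>_. x"] D by auto
qed

text \<open>Continuity as limits along \<open>atin\<close> opens the way to the
  \<open>tendsto\<close> rules for maps from abstract topologies.\<close>

lemma continuous_map_euclidean_iff:
  "continuous_map X euclidean f \<longleftrightarrow> (\<forall>x\<in>topspace X. filterlim f (nhds (f x)) (atin X x))"
  by (simp add: continuous_map_atin)

lemma tendsto_vec2:
  fixes f g :: "'a \<Rightarrow> real"
  assumes "filterlim f (nhds a) F" "filterlim g (nhds b) F"
  shows "filterlim (\<lambda>x. vector [f x, g x] :: real^2) (nhds (vector [a, b])) F"
proof (rule vec_tendstoI)
  fix i :: 2
  show "filterlim (\<lambda>x. (vector [f x, g x] :: real^2) $ i) (nhds (vector [a, b] $ i)) F"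
    using assms exhaust_2[of i] by auto
qed

section \<open>Homology of the circle and of its powers\<close>

abbreviation circle :: "(real^2) topology" where
  "circle \<equiv> top_of_set (sphere 0 1)"

lemma norm_eq_1_iff: "norm (z::real^2) = 1 \<longleftrightarrow> (z$1)\<^sup>2 + (z$2)\<^sup>2 = 1"
  by (simp add: norm_vec_def L2_set_def sum_2)

text \<open>The space \<open>nsphere 1\<close> consists of real sequences supported on the indices 0
  and 1. Forgetting the zeros has a continuous left inverse, so its known homology carries
  over.\<close>

lemma nontrivial_homology_group_circle: "\<not> trivial_group (homology_group 1 circle)"
proof -
  let ?f = "\<lambda>x::nat \<Rightarrow> real. vector [x 0, x 1] :: real^2"
  let ?g = "\<lambda>z i. if i = (0::nat) then z$1 else if i = 1 then (z::real^2)$2 else 0"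
  have "continuous_map (nsphere 1) euclidean ?f"
    using continuous_map_nsphere_projection[of 1]
    by (auto simp: continuous_map_euclidean_iff intro!: tendsto_vec2)
  then have f: "continuous_map (nsphere 1) circle ?f"
    by (auto simp: continuous_map_in_subtopology norm_eq_1_iff nsphere)
  have "continuous_map circle euclideanreal (\<lambda>z. ?g z i)" for i
    by (cases "i = 0"; cases "i = 1") (auto intro!: continuous_intros)
  then have "continuous_map circle (powertop_real UNIV) ?g"
    by (simp add: continuous_map_componentwise_UNIV)
  then have g: "continuous_map circle (nsphere 1) ?g"
    by (auto simp: nsphere continuous_map_in_subtopology norm_eq_1_iff)
  have "?g (?f x) = x" if "x \<in> topspace (nsphere 1)" for x
    using that by (auto simp: nsphere fun_eq_iff)
  moreover have "\<not> trivial_group (homology_group 1 (nsphere 1))"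
    using trivial_reduced_homology_group_nsphere[of 1 1] by (simp add: un_reduced_homology_group)
  ultimately show ?thesis
    using nontrivial_homology_group_section[OF f g] by blast
qed

text \<open>The circle is covered by two overlapping open arcs, above height -1/2 and below height
  1/2. Their intersection splits into a right piece \<open>A\<close> and a left piece
  \<open>B\<close>.\<close>

lemma nontrivial_homology_group_prod_circle:
  assumes p: "p \<noteq> 0" and X: "\<not> trivial_group (homology_group p X)"
  shows "\<not> trivial_group (homology_group (p + 1) (prod_topology X circle))"
proof -
  let ?S = "sphere (0::real^2) 1"
  define P where "P = ?S \<inter> {z. z$2 > -1/2}"
  define Q where "Q = ?S \<inter> {z. z$2 < 1/2}"
  define A where "A = ?S \<inter> {z. z$2 > -1/2 \<and> z$2 < 1/2 \<and> z$1 > 0}"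
  define B where "B = ?S \<inter> {z. z$2 > -1/2 \<and> z$2 < 1/2 \<and> z$1 < 0}"
  define a b where "a = (vector [1, 0] :: real^2)" and "b = (vector [-1, 0] :: real^2)"
  have opens: "openin circle P" "openin circle Q" "openin circle A" "openin circle B"
    unfolding P_def Q_def A_def B_def
    by (intro openin_open_Int open_Collect_conj open_Collect_less continuous_intros)+
  \<comment> \<open>The heights 1 and -1 of the two points with vanishing first coordinate are out
    of range, so its sign separates \<open>A\<close> from \<open>B\<close>.\<close>
  have nz: "z$1 \<noteq> 0" if "z \<in> P \<inter> Q" for z
  proof
    assume z1: "z$1 = 0"
    have "\<bar>z$2\<bar> < 1" "(z$2)\<^sup>2 = 1"
      using that z1 norm_eq_1_iff[of z] by (auto simp: P_def Q_def)
    then show False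
      by (auto simp: power2_eq_1_iff)
  qed
  have PQ: "P \<inter> Q = A \<union> B"
  proof (intro Set.set_eqI iffI)
    show "z \<in> A \<union> B" if "z \<in> P \<inter> Q" for z
      using that nz[OF that] unfolding A_def B_def P_def Q_def by auto
    show "z \<in> P \<inter> Q" if "z \<in> A \<union> B" for z
      using that unfolding A_def B_def P_def Q_def by auto
  qed
  \<comment> \<open>The upper half circle for \<open>s = 1\<close> and the lower one for
    \<open>s = -1\<close>, both running from (1, 0) to (-1, 0).\<close>
  have path: "pathin (subtopology circle D) (\<lambda>t. vector [cos (pi * t), s * sin (pi * t)])"
    if "D = P \<and> s = 1 \<or> D = Q \<and> s = -1" for D s
  proof -
    let ?h = "\<lambda>t. vector [cos (pi * t), s * sin (pi * t)] :: real^2"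
    have "continuous_map (top_of_set {0..1}) euclidean ?h"
      unfolding continuous_map_iff_continuous continuous_on_def
      by (intro ballI tendsto_vec2 tendsto_intros)
    moreover have "?h t \<in> ?S \<inter> D" if "t \<in> {0..1}" for t
    proof -
      have "sin (pi * t) \<ge> 0"
        using that by (intro sin_ge_zero) (auto simp: mult_le_cancel_left1)
      moreover have "s\<^sup>2 = 1"
        using \<open>D = P \<and> s = 1 \<or> D = Q \<and> s = -1\<close> by auto
      then have "?h t \<in> ?S"
        by (simp add: norm_eq_1_iff power_mult_distrib)
      ultimately show ?thesis
        using \<open>D = P \<and> s = 1 \<or> D = Q \<and> s = -1\<close> by (auto simp: P_def Q_def)
    qed
    ultimately show ?thesis
      by (auto simp: pathin_def continuous_map_in_subtopology image_subset_iff)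
  qed
  show ?thesis
  proof (rule nontrivial_homology_group_prod_two_arcs[OF opens(1,2) _ opens(3,4) _ PQ _ _ path _ _ path _ _ p X])
    show "P \<union> Q = topspace circle" "A \<inter> B = {}"
      by (auto simp: P_def Q_def A_def B_def)
    show "vector [1, 0] \<in> A" "vector [-1, 0] \<in> B"
      by (simp_all add: A_def B_def norm_eq_1_iff)
  qed auto
qed

abbreviation torus :: "nat \<Rightarrow> (nat \<Rightarrow> real^2) topology" where
  "torus n \<equiv> product_topology (\<lambda>_. circle) {..<n}"

lemma continuous_map_torus_proj: "i < n \<Longrightarrow> continuous_map (torus n) circle (\<lambda>x. x i)"
  using continuous_map_product_projection[of i "{..<n}" "\<lambda>_. circle"] by simp

text \<open>Induction over the circle factors. It starts at one factor because the product step
  requires a nonzero degree.\<close>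

lemma nontrivial_homology_group_torus_top: "\<not> trivial_group (homology_group (int (Suc n)) (torus (Suc n)))"
proof (induction n)
  case 0
  have "continuous_map circle (torus (Suc 0)) (\<lambda>z. \<lambda>i\<in>{..<Suc 0}. z)"
    by (auto simp: continuous_map_componentwise)
  from nontrivial_homology_group_section[OF this continuous_map_torus_proj[of 0]]
  show ?case
    using nontrivial_homology_group_circle by simp
next
  case (Suc n)
  let ?k = "Suc n"
  let ?f = "\<lambda>(x, z) i. if i \<in> {..<Suc ?k} then if i < ?k then x i else z else undefined"
  let ?g = "\<lambda>y. (restrict y {..<?k}, y ?k)"
  have fst: "continuous_map (prod_topology (torus ?k) circle) circle (\<lambda>w. fst w i)" if "i < ?k" for i
    using continuous_map_compose[OF continuous_map_fst continuous_map_torus_proj[OF that]]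
    by (simp add: o_def)
  have f: "continuous_map (prod_topology (torus ?k) circle) (torus (Suc ?k)) ?f"
    using fst by (auto simp: continuous_map_componentwise extensional_def case_prod_unfold continuous_map_snd)
  have g: "continuous_map (torus (Suc ?k)) (prod_topology (torus ?k) circle) ?g"
    by (auto simp: continuous_map_pairwise o_def continuous_map_componentwise intro!: continuous_map_torus_proj)
  have gf: "?g (?f w) = w" if "w \<in> topspace (prod_topology (torus ?k) circle)" for w
    using that by (auto simp: PiE_def extensional_def fun_eq_iff)
  have "\<not> trivial_group (homology_group (int ?k + 1) (prod_topology (torus ?k) circle))"
    by (rule nontrivial_homology_group_prod_circle[OF _ Suc.IH]) simp
  then have "\<not> trivial_group (homology_group (int ?k + 1) (torus (Suc ?k)))"
    using gf by (intro nontrivial_homology_group_section[OF f g])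
  then show ?case
    by (simp add: add.commute)
qed

lemma vector_1_0_in_sphere: "vector [1, 0] \<in> sphere (0::real^2) 1"
  by (simp add: norm_eq_1_iff)

text \<open>For positive \<open>k\<close>, freezing the coordinates from \<open>k\<close> on at (1,
  0) embeds the \<open>k\<close>-torus with restriction as left inverse, and its top degree is
  already known.\<close>

lemma nontrivial_homology_group_torus:
  assumes "k \<le> n"
  shows "\<not> trivial_group (homology_group (int k) (torus n))"
proof (cases k)
  case 0
  have "topspace (torus n) \<noteq> {}"
    by (auto simp: PiE_eq_empty_iff)
  then show ?thesis
    using nontrivial_homology_group_zero[of "torus n"] 0 by simp
next
  case (Suc j)
  let ?f = "\<lambda>x i. if i \<in> {..<n} then if i < k then x i else vector [1, 0] else undefined"
  let ?g = "\<lambda>y. restrict y {..<k}"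
  have f: "continuous_map (torus k) (torus n) ?f"
    using assms vector_1_0_in_sphere
    by (auto simp: continuous_map_componentwise extensional_def continuous_map_torus_proj)
  have g: "continuous_map (torus n) (torus k) ?g"
    using assms by (auto simp: continuous_map_componentwise intro!: continuous_map_torus_proj)
  have gf: "?g (?f x) = x" if "x \<in> topspace (torus k)" for x
    using that assms by (auto simp: PiE_def extensional_def fun_eq_iff)
  show ?thesis
    using nontrivial_homology_group_torus_top[of j] Suc gf
    by (intro nontrivial_homology_group_section[OF f g]) auto
qed

section \<open>A torus of planar polygons\<close>

definition det2 :: "real^2 \<Rightarrow> real^2 \<Rightarrow> real" where
  "det2 u v = u$1 * v$2 - u$2 * v$1"

lemma inner_2: "(u::real^2) \<bullet> v = u$1 * v$1 + u$2 * v$2"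
  by (simp add: inner_vec_def sum_2)

text \<open>Both sides are the determinant of a product of two matrices, with rows \<open>u\<close>,
  \<open>v\<close> and with columns \<open>p\<close>, \<open>q\<close>. A product of two
  orientations thus becomes an expression in inner products.\<close>

lemma det2_mult_det2:
  "det2 u v * det2 p q = (u \<bullet> p) * (v \<bullet> q) - (u \<bullet> q) * (v \<bullet> p)"
  by (simp add: det2_def inner_2 algebra_simps)

text \<open>Lagrange's identity in the plane.\<close>

lemma inner_det2_square: "(u \<bullet> v)\<^sup>2 + (det2 u v)\<^sup>2 = (norm u)\<^sup>2 * (norm v)\<^sup>2"
  unfolding power2_norm_eq_inner by (simp add: det2_def inner_2 power2_eq_square algebra_simps)

text \<open>For a common point \<open>z\<close>, the vector \<open>z - b\<close> is parallel to both
  edges, so it vanishes when the edges are not parallel.\<close>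

lemma closed_segment_Int_consecutive:
  assumes "det2 (b - a) (c - b) \<noteq> 0"
  shows "closed_segment a b \<inter> closed_segment b c = {b}"
proof -
  have "z = b" if ab: "z \<in> closed_segment a b" and bc: "z \<in> closed_segment b c" for z
  proof -
    obtain s where s: "z = (1 - s) *\<^sub>R a + s *\<^sub>R b"
      using ab unfolding in_segment by blast
    obtain r where r: "z = (1 - r) *\<^sub>R b + r *\<^sub>R c"
      using bc unfolding in_segment by blast
    have "r * det2 (b - a) (c - b) = det2 (b - a) (z - b)"
      unfolding r by (simp add: det2_def algebra_simps)
    also have "\<dots> = 0"
      unfolding s by (simp add: det2_def algebra_simps)
    finally show "z = b"
      using assms r by simp
  qed
  then show ?thesis
    by auto
qed

text \<open>Half-spaces are convex, so a level of the functional that separates the end points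
  separates the segments.\<close>

lemma closed_segment_disjoint:
  fixes u :: "'a::real_inner"
  assumes "u \<bullet> a < u \<bullet> c" "u \<bullet> a < u \<bullet> d" "u \<bullet> b < u \<bullet> c" "u \<bullet> b < u \<bullet> d"
  shows "closed_segment a b \<inter> closed_segment c d = {}"
proof -
  let ?s = "max (u \<bullet> a) (u \<bullet> b)"
  have "closed_segment a b \<subseteq> {z. u \<bullet> z \<le> ?s}"
    by (rule closed_segment_subset[OF _ _ convex_halfspace_le]) auto
  moreover have "closed_segment c d \<subseteq> {z. u \<bullet> z > ?s}"
    using assms by (intro closed_segment_subset[OF _ _ convex_halfspace_gt]) auto
  ultimately show ?thesis
    by fastforce
qed

text \<open>Two consecutive steps gain at least 5/2, so only a single odd step can lead backwards;
  the last hypothesis excludes exactly that case.\<close>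

lemma zigzag_less:
  fixes f :: "nat \<Rightarrow> real"
  assumes even: "\<And>k. k < N \<Longrightarrow> even k \<Longrightarrow> f k + 4 \<le> f (Suc k)"
    and odd: "\<And>k. k < N \<Longrightarrow> odd k \<Longrightarrow> f k - 3/2 \<le> f (Suc k)"
    and ij: "i < j" "j \<le> N" "even i \<or> i + 2 \<le> j"
  shows "f i < f j"
proof -
  \<comment> \<open>The mean gain per step is at least 5/4; the parity term smooths out the alternation.\<close>
  define h where "h k = 4 * f k - 5 * real k - (if odd k then 11 else 0)" for k
  have step: "h k \<le> h (Suc k)" if "k < N" for k
    using even[OF that] odd[OF that] by (auto simp: h_def)
  have "h i \<le> h j"
    using ij(1,2)
  proof (induction j)
    case (Suc j)
    then show ?case
      using step[of j] by (cases "i = j") auto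
  qed simp
  \<comment> \<open>The parity term costs 11 only for odd \<open>i\<close> and even
    \<open>j\<close>. Then \<open>j - i\<close> is odd and at least 3, which gains 15.\<close>
  moreover have "even i \<and> real i + 1 \<le> real j \<or> odd i \<and> odd j \<and> real i + 2 \<le> real j \<or> real i + 3 \<le> real j"
    using ij by (cases "j = i + 2") auto
  ultimately show ?thesis
    unfolding h_def by (auto split: if_splits)
qed

text \<open>The short bars have total length \<open>5 * m\<close>, less than a twelfth of this.
  Hence the long bars determine the shape of the triangle up to a small error.\<close>

definition arm :: "nat \<Rightarrow> real" where
  "arm m = 60 * (real m + 1)"

text \<open>Vertex 0 of the linkage is the far end \<open>A\<close> of the chain, vertex 1 is \<open>B\<close> and vertex
  2 is the origin \<open>C\<close>, where the chain starts.\<close>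

definition fan_linkage :: "nat \<Rightarrow> real list" where
  "fan_linkage m = map (\<lambda>i. if i \<le> 2 then arm m else if even i then 4 else 1) [0..<2 * m + 3]"

text \<open>The index counts from the vertex \<open>C\<close>: step \<open>k\<close> runs along edge
  \<open>k + 2\<close>, and step \<open>2 * j + 1\<close> is the unit bar with direction
  \<open>x j\<close>.\<close>

definition chain_step :: "nat \<Rightarrow> (nat \<Rightarrow> real^2) \<Rightarrow> nat \<Rightarrow> real^2" where
  "chain_step m x k = (if k = 0 then vector [arm m, 0] else if even k then vector [4, 0] else x (k div 2))"

definition chain :: "nat \<Rightarrow> (nat \<Rightarrow> real^2) \<Rightarrow> nat \<Rightarrow> real^2" where
  "chain m x k = (\<Sum>i<k. chain_step m x i)"

text \<open>The apex of the isosceles triangle with legs \<open>l\<close> over the base from 0 to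
  \<open>a\<close>, on the left of \<open>a\<close>: half the base plus the height, along
  \<open>a\<close> turned by a right angle.\<close>

definition apex :: "real \<Rightarrow> real^2 \<Rightarrow> real^2" where
  "apex l a = (1/2) *\<^sub>R a + sqrt (l\<^sup>2 / (norm a)\<^sup>2 - 1/4) *\<^sub>R vector [- (a$2), a$1]"

definition fan :: "nat \<Rightarrow> (nat \<Rightarrow> real^2) \<Rightarrow> nat \<Rightarrow> real^2" where
  "fan m x = (\<lambda>i\<in>{..<2 * m + 3}. if i = 0 then chain m x (2 * m + 1)
     else if i = 1 then apex (arm m) (chain m x (2 * m + 1)) else chain m x (i - 2))"

section \<open>Metric estimates for the chain and the apex\<close>

lemma arm_pos: "arm m > 0"
  by (simp add: arm_def)

lemma length_fan_linkage [simp]: "length (fan_linkage m) = 2 * m + 3"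
  by (simp add: fan_linkage_def)

lemma nth_fan_linkage:
  "i < 2 * m + 3 \<Longrightarrow> fan_linkage m ! i = (if i \<le> 2 then arm m else if even i then 4 else 1)"
  by (simp add: fan_linkage_def del: upt_Suc)

lemma linkage_fan_linkage: "linkage (fan_linkage m)"
  using arm_pos by (auto simp: linkage_def fan_linkage_def)

lemma chain_0 [simp]: "chain m x 0 = 0"
  and chain_Suc: "chain m x (Suc k) = chain m x k + chain_step m x k"
  by (simp_all add: chain_def)

text \<open>Pythagoras for half the base and the height; the bound on \<open>norm a\<close> keeps
  the radicand nonnegative.\<close>

lemma norm_apex:
  assumes a: "a \<noteq> 0" "norm a \<le> 2 * l" and l: "l > 0"
  shows "norm (apex l a) = l" "norm (apex l a - a) = l"
proof -
  define t where "t = sqrt (l\<^sup>2 / (norm a)\<^sup>2 - 1/4)"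
  have n: "(norm a)\<^sup>2 = (a$1)\<^sup>2 + (a$2)\<^sup>2"
    unfolding power2_norm_eq_inner by (simp add: inner_2 power2_eq_square)
  then have n': "norm a * norm a = a$1 * a$1 + a$2 * a$2"
    by (simp add: power2_eq_square)
  have na: "(norm a)\<^sup>2 > 0"
    using a by simp
  have "(norm a)\<^sup>2 \<le> (2 * l)\<^sup>2"
    using a by (intro power_mono) auto
  then have "l\<^sup>2 / (norm a)\<^sup>2 - 1/4 \<ge> 0"
    using na by (simp add: field_simps)
  then have t: "t\<^sup>2 = l\<^sup>2 / (norm a)\<^sup>2 - 1/4"
    by (simp add: t_def)
  then have t2: "(1/4 + t\<^sup>2) * (norm a)\<^sup>2 = l\<^sup>2"
    using na by simp
  have "(norm (apex l a))\<^sup>2 = (1/4 + t\<^sup>2) * (norm a)\<^sup>2"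
    unfolding power2_norm_eq_inner inner_2[of "apex l a"] n
    by (simp add: apex_def flip: t_def power2_norm_eq_inner) (simp add: n' power2_eq_square algebra_simps)
  then show "norm (apex l a) = l"
    using t2 l by (metis norm_ge_zero order_less_imp_le power2_eq_imp_eq)
  have "(norm (apex l a - a))\<^sup>2 = (1/4 + t\<^sup>2) * (norm a)\<^sup>2"
    unfolding power2_norm_eq_inner inner_2[of "apex l a - a"] n
    by (simp add: apex_def flip: t_def power2_norm_eq_inner) (simp add: n' power2_eq_square algebra_simps)
  then show "norm (apex l a - a) = l"
    using t2 l by (metis norm_ge_zero order_less_imp_le power2_eq_imp_eq)
qed

context
  fixes m :: nat and x :: "nat \<Rightarrow> real^2"
  assumes unit: "\<And>j. j < m \<Longrightarrow> norm (x j) = 1"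
begin

lemma chain_step_even:
  assumes "even k"
  shows "chain_step m x k $ 1 \<ge> 4" "chain_step m x k $ 2 = 0"
  using assms by (auto simp: chain_step_def arm_def)

lemma chain_step_odd:
  assumes "odd k" "k < 2 * m + 1"
  shows "norm (chain_step m x k) = 1"
    "\<bar>chain_step m x k $ 1\<bar> \<le> 1" "\<bar>chain_step m x k $ 2\<bar> \<le> 1"
    "\<bar>chain_step m x k $ 1 + chain_step m x k $ 2\<bar> \<le> 3/2"
    "\<bar>chain_step m x k $ 1 - chain_step m x k $ 2\<bar> \<le> 3/2"
proof -
  let ?v = "chain_step m x k"
  have "k div 2 < m"
    using assms by (auto elim!: oddE)
  then show n: "norm ?v = 1"
    using assms unit by (auto simp: chain_step_def)
  show "\<bar>?v $ 1\<bar> \<le> 1" "\<bar>?v $ 2\<bar> \<le> 1"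
    using component_le_norm_cart[of ?v] n by metis+
  have v: "(?v$1)\<^sup>2 + (?v$2)\<^sup>2 = 1"
    using n by (simp add: norm_eq_1_iff)
  \<comment> \<open>The two squares add up to 2, so each is at most 2, which is below 9/4.\<close>
  have "(?v$1 + ?v$2)\<^sup>2 \<le> (3/2)\<^sup>2" "(?v$1 - ?v$2)\<^sup>2 \<le> (3/2)\<^sup>2"
    using v zero_le_power2[of "?v$1 - ?v$2"] zero_le_power2[of "?v$1 + ?v$2"]
    unfolding power2_sum power2_diff by (simp_all add: power2_eq_square)
  then have "\<bar>?v$1 + ?v$2\<bar> \<le> \<bar>3/2\<bar>" "\<bar>?v$1 - ?v$2\<bar> \<le> \<bar>3/2\<bar>"
    unfolding abs_le_square_iff .
  then show "\<bar>?v$1 + ?v$2\<bar> \<le> 3/2" "\<bar>?v$1 - ?v$2\<bar> \<le> 3/2"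
    by simp_all
qed

text \<open>The three functionals separate edges: (1, 0) two edges of the chain, (1, 1) the chain
  from \<open>AB\<close>, and (1, -1) the chain from \<open>BC\<close>.\<close>

lemma inner_chain_less:
  assumes u: "u = vector [1, 0] \<or> u = vector [1, 1] \<or> u = vector [1, -1]"
    and ij: "i < j" "j \<le> 2 * m + 1" "even i \<or> i + 2 \<le> j"
  shows "u \<bullet> chain m x i < u \<bullet> chain m x j"
proof (rule zigzag_less[OF _ _ ij])
  fix k assume k: "k < 2 * m + 1"
  show "u \<bullet> chain m x k + 4 \<le> u \<bullet> chain m x (Suc k)" if "even k"
    using u chain_step_even[OF that] by (auto simp: chain_Suc inner_2)
  show "u \<bullet> chain m x k - 3/2 \<le> u \<bullet> chain m x (Suc k)" if "odd k"
    using u chain_step_odd(2,4,5)[OF that k] unfolding abs_le_iff by (auto simp: chain_Suc inner_2)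
qed

lemma chain_bounds:
  "j \<le> m \<Longrightarrow> arm m \<le> chain m x (2 * j + 1) $ 1 \<and> chain m x (2 * j + 1) $ 1 \<le> arm m + 5 * real j
    \<and> \<bar>chain m x (2 * j + 1) $ 2\<bar> \<le> real j"
proof (induction j)
  case 0
  then show ?case
    by (simp add: chain_Suc chain_step_def)
next
  case (Suc j)
  have "2 * Suc j + 1 = Suc (Suc (2 * j + 1))"
    by simp
  then have "chain m x (2 * Suc j + 1) = chain m x (2 * j + 1) + chain_step m x (2 * j + 1) + chain_step m x (Suc (2 * j + 1))"
    by (simp only: chain_Suc)
  moreover have "chain_step m x (Suc (2 * j + 1)) = vector [4, 0]"
    by (simp add: chain_step_def)
  moreover have "\<bar>chain_step m x (2 * j + 1) $ 1\<bar> \<le> 1" "\<bar>chain_step m x (2 * j + 1) $ 2\<bar> \<le> 1"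
    using Suc.prems by (auto intro!: chain_step_odd)
  ultimately show ?case
    using Suc by (auto simp del: mult_Suc_right)
qed

abbreviation "foot \<equiv> chain m x (2 * m + 1)"
abbreviation "tip \<equiv> apex (arm m) foot"

lemma foot_bounds: "arm m \<le> foot $ 1" "foot $ 1 \<le> 13/12 * arm m" "\<bar>foot $ 2\<bar> \<le> arm m / 60"
  using chain_bounds[OF order_refl] by (auto simp: arm_def)

text \<open>Here \<open>t\<close> is the ratio of height to base, close to the value
  \<open>sqrt 3 / 2\<close> of an equilateral triangle.\<close>

lemma apex_bounds:
  obtains t where "3/4 \<le> t" "t \<le> 1" "tip $ 1 = foot $ 1 / 2 - t * foot $ 2" "tip $ 2 = foot $ 2 / 2 + t * foot $ 1"
    "norm tip = arm m" "norm (tip - foot) = arm m"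
proof -
  define t where "t = sqrt ((arm m)\<^sup>2 / (norm foot)\<^sup>2 - 1/4)"
  have l: "arm m > 0"
    by (rule arm_pos)
  have n: "(norm foot)\<^sup>2 = (foot $ 1)\<^sup>2 + (foot $ 2)\<^sup>2"
    unfolding power2_norm_eq_inner by (simp add: inner_2 power2_eq_square)
  have 1: "(arm m)\<^sup>2 \<le> (foot $ 1)\<^sup>2" "(foot $ 1)\<^sup>2 \<le> (13/12 * arm m)\<^sup>2" "(foot $ 2)\<^sup>2 \<le> (arm m / 60)\<^sup>2"
    using foot_bounds l by (auto intro: power_mono simp: abs_le_square_iff[symmetric])
  moreover have "(13/12 * arm m)\<^sup>2 = 169/144 * (arm m)\<^sup>2" "(arm m / 60)\<^sup>2 = (arm m)\<^sup>2 / 3600"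
    by (simp_all add: power2_eq_square)
  \<comment> \<open>The constant 6/5 exceeds (13/12)^2 + 1/3600, and 5/6 - 1/4 = 7/12 still exceeds
    (3/4)^2.\<close>
  ultimately have n1: "(arm m)\<^sup>2 \<le> (norm foot)\<^sup>2" and n2: "(norm foot)\<^sup>2 \<le> 6/5 * (arm m)\<^sup>2"
    unfolding n using zero_le_power2[of "foot $ 2"] zero_le_power2[of "arm m"] by linarith+
  have pos: "(norm foot)\<^sup>2 > 0"
    using n1 l by (smt (verit) zero_less_power)
  have "5/6 \<le> (arm m)\<^sup>2 / (norm foot)\<^sup>2" "(arm m)\<^sup>2 / (norm foot)\<^sup>2 \<le> 1"
    using n1 n2 pos by (simp_all add: field_simps)
  then have "(3/4)\<^sup>2 \<le> (arm m)\<^sup>2 / (norm foot)\<^sup>2 - 1/4" "(arm m)\<^sup>2 / (norm foot)\<^sup>2 - 1/4 \<le> 1\<^sup>2"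
    by (simp_all add: power2_eq_square)
  then have t: "3/4 \<le> t" "t \<le> 1"
    unfolding t_def by (blast intro: real_le_rsqrt, simp)
  have "(2 * arm m)\<^sup>2 = 4 * (arm m)\<^sup>2"
    by (simp add: power_mult_distrib)
  then have "(norm foot)\<^sup>2 \<le> (2 * arm m)\<^sup>2"
    using n2 zero_le_power2[of "arm m"] by linarith
  then have "norm foot \<le> 2 * arm m"
    by (rule power2_le_imp_le) (simp add: less_imp_le l)
  moreover have "foot \<noteq> 0"
    using pos by auto
  ultimately have "norm tip = arm m" "norm (tip - foot) = arm m"
    using norm_apex l by blast+
  moreover have "tip $ 1 = foot $ 1 / 2 - t * foot $ 2" "tip $ 2 = foot $ 2 / 2 + t * foot $ 1"
    by (simp_all add: apex_def t_def)
  ultimately show ?thesis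
    using that t by blast
qed

text \<open>The first two inequalities put \<open>BC\<close> and \<open>AB\<close> on the proper
  sides of the chain for the functionals (1, -1) and (1, 1). The next two make these edges
  nonhorizontal, and the last one orients the triangle.\<close>

lemma tip_ineqs:
  shows "tip $ 1 < tip $ 2" "foot $ 1 + foot $ 2 < tip $ 1 + tip $ 2" "0 < tip $ 2" "foot $ 2 < tip $ 2"
    "0 < det2 foot tip"
proof -
  obtain t where t: "3/4 \<le> t" "t \<le> 1" and tip: "tip $ 1 = foot $ 1 / 2 - t * foot $ 2" "tip $ 2 = foot $ 2 / 2 + t * foot $ 1"
    by (rule apex_bounds) 
  have l: "arm m > 0"
    by (rule arm_pos)
  \<comment> \<open>The diagonal inequalities compare \<open>(t - 1/2) * foot $ 1\<close>, at least
    a quarter of the arm, with \<open>(t + 1/2) * foot $ 2\<close>, at most a fortieth in absolute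
    value.\<close>
  have p: "1/4 * arm m \<le> (t - 1/2) * foot $ 1"
    by (rule mult_mono) (use t l foot_bounds in auto)
  have p': "3/4 * arm m \<le> t * foot $ 1"
    by (rule mult_mono) (use t l foot_bounds in auto)
  have "\<bar>(t + 1/2) * foot $ 2\<bar> \<le> 3/2 * (arm m / 60)"
    using t l foot_bounds unfolding abs_mult by (intro mult_mono) auto
  then have q: "\<bar>t * foot $ 2 + foot $ 2 / 2\<bar> \<le> arm m / 40"
    by (simp add: algebra_simps)
  show "tip $ 1 < tip $ 2" "foot $ 1 + foot $ 2 < tip $ 1 + tip $ 2" "0 < tip $ 2" "foot $ 2 < tip $ 2"
    unfolding tip using p p' q l foot_bounds unfolding left_diff_distrib abs_le_iff by linarith+
  have "det2 foot tip = t * ((foot $ 1)\<^sup>2 + (foot $ 2)\<^sup>2)"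
    unfolding det2_def tip by (simp add: power2_eq_square algebra_simps)
  moreover have "foot $ 1 > 0"
    using l foot_bounds by linarith
  ultimately show "0 < det2 foot tip"
    using t by (simp add: add_pos_nonneg)
qed

end

section \<open>The fans as simple configurations\<close>

lemma next_index_fan_linkage:
  "next_index (fan_linkage m) 0 = 1" "next_index (fan_linkage m) (Suc 0) = 2"
  "k < 2 * m \<Longrightarrow> next_index (fan_linkage m) (k + 2) = k + 3"
  "next_index (fan_linkage m) (2 * m + 2) = 0"
proof -
  show "next_index (fan_linkage m) 0 = 1" "next_index (fan_linkage m) (Suc 0) = 2"
    "k < 2 * m \<Longrightarrow> next_index (fan_linkage m) (k + 2) = k + 3"
    by (simp_all add: next_index_def)
  have "2 * m + 2 + 1 = 2 * m + 3"
    by simp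
  then show "next_index (fan_linkage m) (2 * m + 2) = 0"
    by (simp only: next_index_def length_fan_linkage mod_self)
qed

lemma fan_index_cases:
  fixes i m :: nat
  assumes "i < 2 * m + 3"
  obtains "i = 0" | "i = 1" | k where "i = k + 2" "k < 2 * m" | "i = 2 * m + 2"
proof -
  have "i = 0 \<or> i = 1 \<or> i = (i - 2) + 2 \<and> i - 2 < 2 * m \<or> i = 2 * m + 2"
    using assms by linarith
  then show ?thesis
    using that by metis
qed

lemma fan_nth:
  "fan m x 0 = chain m x (2 * m + 1)" "fan m x (Suc 0) = apex (arm m) (chain m x (2 * m + 1))"
  "k \<le> 2 * m \<Longrightarrow> fan m x (k + 2) = chain m x k"
  "fan m x 2 = 0"
  by (simp_all add: fan_def)

text \<open>The wrap-around at \<open>k = 2 * m\<close> fits the same formula because vertex 0 is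
  the end of the chain.\<close>

lemma fan_next:
  assumes "k \<le> 2 * m"
  shows "fan m x (next_index (fan_linkage m) (k + 2)) = chain m x (Suc k)"
proof (cases "k = 2 * m")
  case True
  then show ?thesis
    by (simp only: next_index_fan_linkage fan_nth) simp
next
  case False
  then have "next_index (fan_linkage m) (k + 2) = Suc k + 2" "Suc k \<le> 2 * m"
    using assms next_index_fan_linkage(3)[of k m] by simp_all
  then show ?thesis
    by (simp only: fan_nth)
qed

lemma edge_fan:
  "edge (fan_linkage m) (fan m x) 0 = closed_segment (chain m x (2 * m + 1)) (apex (arm m) (chain m x (2 * m + 1)))"
  "edge (fan_linkage m) (fan m x) (Suc 0) = closed_segment (apex (arm m) (chain m x (2 * m + 1))) 0"
  "k \<le> 2 * m \<Longrightarrow> edge (fan_linkage m) (fan m x) (k + 2) = closed_segment (chain m x k) (chain m x (Suc k))"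
  subgoal
    unfolding edge_def next_index_fan_linkage by (simp add: fan_nth)
  subgoal
    unfolding edge_def next_index_fan_linkage by (simp add: fan_nth)
  subgoal
    unfolding edge_def by (simp only: fan_next fan_nth(3))
  done

lemma fan_in_configurations:
  assumes unit: "\<And>j. j < m \<Longrightarrow> norm (x j) = 1"
  shows "fan m x \<in> configurations (fan_linkage m)"
proof -
  let ?P = "fan_linkage m"
  obtain t where tip: "norm (apex (arm m) (chain m x (2 * m + 1))) = arm m"
    "norm (apex (arm m) (chain m x (2 * m + 1)) - chain m x (2 * m + 1)) = arm m"
    using apex_bounds[of m x, OF unit] by metis
  have chain: "dist (fan m x (k + 2)) (fan m x (next_index ?P (k + 2))) = ?P ! (k + 2)" if k: "k \<le> 2 * m" for k
  proof -
    have "dist (fan m x (k + 2)) (fan m x (next_index ?P (k + 2))) = norm (chain_step m x k)"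
      unfolding fan_next[OF k] fan_nth(3)[OF k] by (simp add: chain_Suc dist_norm)
    also have "\<dots> = ?P ! (k + 2)"
    proof (cases "odd k")
      case True
      then show ?thesis
        using chain_step_odd(1)[of m x, OF unit True] k by (auto simp: nth_fan_linkage)
    next
      case False
      then show ?thesis
        using k arm_pos[of m] by (auto simp: nth_fan_linkage chain_step_def norm_vec_def L2_set_def sum_2)
    qed
    finally show ?thesis .
  qed
  have "dist (fan m x i) (fan m x (next_index ?P i)) = ?P ! i" if "i < 2 * m + 3" for i
    using that
  proof (cases rule: fan_index_cases)
    case 1
    then show ?thesis
      using tip by (simp add: fan_nth next_index_fan_linkage nth_fan_linkage dist_norm norm_minus_commute)
  next
    case 2
    then show ?thesis
      using tip by (simp add: fan_nth next_index_fan_linkage nth_fan_linkage dist_norm)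
  next
    case (3 k)
    then show ?thesis
      using chain[of k] by simp
  next
    case 4
    then show ?thesis
      using chain[of "2 * m"] by simp
  qed
  moreover have "fan m x \<in> topspace (plane_power (2 * m + 3))"
    by (simp add: plane_power_def fan_def)
  ultimately show ?thesis
    by (simp add: configurations_def)
qed

text \<open>Consecutive edges are never parallel, and all other pairs of edges are separated by a
  linear functional.\<close>

lemma self_intersection_free_fan:
  assumes unit: "\<And>j. j < m \<Longrightarrow> norm (x j) = 1" and gen: "\<And>j. j < m \<Longrightarrow> x j $ 2 \<noteq> 0"
  shows "self_intersection_free (fan_linkage m) (fan m x)"
proof -
  let ?P = "fan_linkage m" and ?a = "fan m x" and ?W = "chain m x"
  define foot where "foot = ?W (2 * m + 1)"
  define tip where "tip = apex (arm m) foot"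
  have edge: "edge ?P ?a 0 = closed_segment foot tip" "edge ?P ?a (Suc 0) = closed_segment tip 0"
    "\<And>k. k \<le> 2 * m \<Longrightarrow> edge ?P ?a (k + 2) = closed_segment (?W k) (?W (Suc k))"
    unfolding foot_def tip_def by (rule edge_fan; assumption)+
  note ineqs = tip_ineqs[of m x, OF unit, folded foot_def, folded tip_def]
  have even_step: "?W (Suc k) $ 1 - ?W k $ 1 \<ge> 4" "?W (Suc k) $ 2 = ?W k $ 2" if "even k" for k
    using chain_step_even[of m x, OF unit that] by (simp_all add: chain_Suc)
  have odd_step: "?W (Suc k) $ 2 \<noteq> ?W k $ 2" if "odd k" "k < 2 * m" for k
    using that gen[of "k div 2"] by (auto simp: chain_Suc chain_step_def elim!: oddE)
  note less = inner_chain_less[of m x, OF unit]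
  have consecutive: "edge ?P ?a i \<inter> edge ?P ?a (next_index ?P i) = {?a (next_index ?P i)}" if "i < 2 * m + 3" for i
    using that
  proof (cases rule: fan_index_cases)
    case 1
    have "det2 (tip - foot) (0 - tip) = det2 foot tip"
      by (simp add: det2_def algebra_simps)
    then show ?thesis
      using 1 ineqs closed_segment_Int_consecutive[of tip foot 0] fan_nth(2)[of m x, folded foot_def, folded tip_def]
      by (simp add: next_index_fan_linkage edge)
  next
    case 2
    have "?W 1 $ 1 \<noteq> 0" "?W 1 $ 2 = 0"
      using even_step[of 0] by simp_all
    then have "det2 (0 - tip) (?W 1 - 0) \<noteq> 0"
      using ineqs by (simp add: det2_def)
    then show ?thesis
      using 2 closed_segment_Int_consecutive[of 0 tip "?W 1"] edge(3)[of 0]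
      by (simp add: next_index_fan_linkage edge fan_nth(4) numeral_2_eq_2[symmetric])
  next
    case (3 k)
    \<comment> \<open>One of the two edges is horizontal and the other is a nonhorizontal unit
      bar.\<close>
    have "det2 (?W (Suc k) - ?W k) (?W (Suc (Suc k)) - ?W (Suc k)) \<noteq> 0"
      using even_step[of k] odd_step[of k] even_step[of "Suc k"] odd_step[of "Suc k"] 3
      by (cases "even k") (auto simp: det2_def) 
    moreover have "next_index ?P i = Suc k + 2"
      using 3 next_index_fan_linkage(3)[of k m] by simp
    ultimately show ?thesis
      using 3 closed_segment_Int_consecutive[of "?W (Suc k)" "?W k" "?W (Suc (Suc k))"] edge(3)[of k] edge(3)[of "Suc k"]
        fan_nth(3)[of "Suc k" m x]
      by simp
  next
    case 4
    have "det2 (foot - ?W (2 * m)) (tip - foot) \<noteq> 0"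
      using even_step[of "2 * m"] ineqs by (simp add: det2_def foot_def)
    then show ?thesis
      using 4 closed_segment_Int_consecutive[of foot "?W (2 * m)" tip] edge(3)[of "2 * m"] fan_nth(1)[of m x]
        next_index_fan_linkage(4)[of m]
      by (simp add: edge foot_def)
  qed
  have chain_disjoint: "closed_segment (?W k) (?W (Suc k)) \<inter> closed_segment (?W l) (?W (Suc l)) = {}"
    if kl: "k + 2 \<le> l" "l \<le> 2 * m" for k l
  \<comment> \<open>Two horizontal bars joined by one unit bar may overlap horizontally when that
    bar points backwards, but their heights differ. All other pairs are in horizontal order.\<close>
  proof (cases "even k \<and> l = k + 2")
    case True
    let ?u = "vector [0, 1] :: real^2"
    have "?W (Suc k) $ 2 = ?W k $ 2" "?W (Suc l) $ 2 = ?W l $ 2" "?W l $ 2 \<noteq> ?W k $ 2"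
      using True even_step[of k] even_step[of l] odd_step[of "Suc k"] kl by auto
    then show ?thesis
      using closed_segment_disjoint[of ?u "?W k" "?W l" "?W (Suc l)" "?W (Suc k)"]
        closed_segment_disjoint[of ?u "?W l" "?W k" "?W (Suc k)" "?W (Suc l)"]
      by (cases "?W k $ 2 < ?W l $ 2") (auto simp: inner_2 Int_commute)
  next
    case False
    have "even (Suc k) \<or> Suc k + 2 \<le> l"
      using False kl by auto
    then show ?thesis
      using kl by (intro closed_segment_disjoint[of "vector [1, 0]"] less) auto
  qed
  have disjoint: "edge ?P ?a i \<inter> edge ?P ?a j = {}"
    if ij: "i < j" "j < 2 * m + 3" "j \<noteq> next_index ?P i" "i \<noteq> next_index ?P j" for i j
  proof -
    consider "i = 0" | "i = 1" | "i \<ge> 2"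
      by linarith
    then show ?thesis
    proof cases
      case 1
      have "j \<noteq> 1" "j \<noteq> 2 * m + 2"
        using ij 1 next_index_fan_linkage(1,4)[of m] by auto
      then obtain k where k: "j = k + 2" "k < 2 * m"
        using ij 1 by (elim fan_index_cases) auto
      \<comment> \<open>The vertex next to the foot has the even index \<open>2 * m\<close>, so the
        exceptional case of an odd last step does not occur.\<close>
      have "even (Suc k) \<or> Suc k + 2 \<le> 2 * m + 1"
        using k by presburger
      then have "closed_segment (?W k) (?W (Suc k)) \<inter> closed_segment foot tip = {}"
        using k ineqs less[of "vector [1, 1]" k "2 * m + 1"] less[of "vector [1, 1]" "Suc k" "2 * m + 1"]
        by (intro closed_segment_disjoint[of "vector [1, 1]"]) (auto simp: inner_2 foot_def)
      then show ?thesis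
        using k 1 edge(3)[of k] by (simp add: edge(1) Int_commute)
    next
      case 2
      have "j \<noteq> 2"
        using ij 2 next_index_fan_linkage(2)[of m] by auto
      define k where "k = j - 2"
      have k: "j = k + 2" "1 \<le> k" "k \<le> 2 * m"
        using ij 2 \<open>j \<noteq> 2\<close> by (auto simp: k_def)
      then have "closed_segment tip 0 \<inter> closed_segment (?W k) (?W (Suc k)) = {}"
        using ineqs less[of "vector [1, -1]" 0 k] less[of "vector [1, -1]" 0 "Suc k"]
        by (intro closed_segment_disjoint[of "vector [1, -1]"]) (auto simp: inner_2)
      then show ?thesis
        using k 2 edge(3)[of k] by (simp add: edge(2))
    next
      case 3
      define k l where "k = i - 2" and "l = j - 2"
      have kl: "i = k + 2" "j = l + 2" "k < l" "l \<le> 2 * m"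
        using 3 ij by (auto simp: k_def l_def)
      have "l \<noteq> Suc k"
        using ij kl next_index_fan_linkage(3)[of k m] by auto
      then show ?thesis
        using kl chain_disjoint[of k l] edge(3)[of k] edge(3)[of l] by simp
    qed
  qed
  have "edge ?P ?a i \<inter> edge ?P ?a j = {}"
    if "i < 2 * m + 3" "j < 2 * m + 3" "i \<noteq> j" "j \<noteq> next_index ?P i" "i \<noteq> next_index ?P j" for i j
    using disjoint[of i j] disjoint[of j i] that by (cases "i < j") (auto simp: Int_commute)
  then show ?thesis
    using consecutive by (simp add: self_intersection_free_def)
qed

section \<open>Density of generic directions and continuity of the fans\<close>

lemma chain_step_direction: "j < m \<Longrightarrow> chain_step m x (Suc (2 * j)) = x j"
  by (simp add: chain_step_def)

lemma circle_closure_of_nonhorizontal: "circle closure_of {z \<in> sphere 0 1. z $ 2 \<noteq> 0} = sphere 0 1"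
proof -
  let ?T = "{z \<in> sphere (0::real^2) 1. z $ 2 \<noteq> 0}"
  have "z \<in> closure ?T" if z: "norm z = 1" for z :: "real^2"
  proof (cases "z $ 2 = 0")
    case True
    then have z1: "(z $ 1)\<^sup>2 = 1"
      using z by (simp add: norm_eq_1_iff)
    \<comment> \<open>The two horizontal points are approximated by turning them through the angles
      \<open>1 / Suc n\<close>.\<close>
    define w where "w n = (vector [z $ 1 * cos (1 / real (Suc n)), sin (1 / real (Suc n))] :: real^2)" for n
    have "w n \<in> ?T" for n
    proof -
      have "1 / real (Suc n) \<le> 1"
        by simp
      then have "1 / real (Suc n) < pi"
        using pi_gt3 by linarith
      then have "sin (1 / real (Suc n)) > 0"
        by (intro sin_gt_zero) auto
      then show ?thesis
        using z1 by (simp add: w_def norm_eq_1_iff power_mult_distrib)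
    qed
    moreover have "filterlim w (nhds z) sequentially"
    proof -
      have 0: "filterlim (\<lambda>n. 1 / real (Suc n)) (nhds 0) sequentially"
        using LIMSEQ_inverse_real_of_nat by (simp add: inverse_eq_divide)
      have "filterlim w (nhds (vector [z $ 1 * cos 0, sin 0])) sequentially"
        unfolding w_def by (intro tendsto_vec2 tendsto_intros 0)
      moreover have "vector [z $ 1 * cos 0, sin 0] = z"
        using True by (simp add: vec_eq_iff forall_2)
      ultimately show ?thesis
        by simp
    qed
    ultimately show ?thesis
      unfolding closure_sequential by blast
  next
    case False
    then show ?thesis
      using z by (intro subsetD[OF closure_subset]) auto
  qed
  moreover have "sphere 0 1 \<inter> ?T = ?T"
    by auto
  ultimately show ?thesis
    by (auto simp: closure_of_subtopology)
qed

lemma torus_closure_of_generic: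
  "torus m closure_of {x \<in> topspace (torus m). \<forall>j<m. x j $ 2 \<noteq> 0} = topspace (torus m)"
proof -
  \<comment> \<open>Genericity is a condition on each coordinate, and closures commute with
    products.\<close>
  have "{x \<in> topspace (torus m). \<forall>j<m. x j $ 2 \<noteq> 0} = (\<Pi>\<^sub>E j\<in>{..<m}. {z \<in> sphere 0 1. z $ 2 \<noteq> 0})"
    unfolding topspace_product_topology topspace_euclidean_subtopology
    by (rule Set.set_eqI) (simp only: mem_Collect_eq PiE_iff lessThan_iff Ball_def, blast)
  then show ?thesis
    by (simp only: closure_of_product_topology circle_closure_of_nonhorizontal topspace_product_topology
        topspace_euclidean_subtopology)
qed

lemma torus_norm: "x \<in> topspace (torus m) \<Longrightarrow> j < m \<Longrightarrow> norm (x j) = 1"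
  by (auto simp: PiE_iff)

lemma continuous_map_fan: "continuous_map (torus m) (plane_power (2 * m + 3)) (fan m)"
proof -
  have step: "continuous_map (torus m) euclidean (\<lambda>x. chain_step m x k)" if "k < 2 * m + 1" for k
  proof (cases "odd k")
    case True
    then have "k div 2 < m"
      using that by (auto elim!: oddE)
    then have "continuous_map (torus m) euclidean (\<lambda>x. x (k div 2))"
      using continuous_map_torus_proj[of "k div 2" m] by (simp add: continuous_map_in_subtopology)
    then show ?thesis
      using True by (auto simp: chain_step_def)
  qed (auto simp: chain_step_def)
  have chain: "continuous_map (torus m) euclidean (\<lambda>x. chain m x k)" if "k \<le> 2 * m + 1" for k
    using step that unfolding chain_def continuous_map_euclidean_iff by (auto intro!: tendsto_sum)
  have tip: "continuous_map (torus m) euclidean (\<lambda>x. tip m x)"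
    unfolding continuous_map_euclidean_iff apex_def
  proof (intro ballI tendsto_add tendsto_scaleR tendsto_const tendsto_vec2 tendsto_real_sqrt
      tendsto_diff tendsto_divide tendsto_power tendsto_norm tendsto_minus tendsto_vec_nth)
    fix x assume x: "x \<in> topspace (torus m)"
    \<comment> \<open>The radicand divides by the squared base, nonzero because the triangle is
      nondegenerate.\<close>
    show "(norm (foot m x))\<^sup>2 \<noteq> 0"
      using tip_ineqs(5)[of m x, OF torus_norm[OF x]] by (auto simp: det2_def)
  qed (use chain[of "2 * m + 1"] in \<open>auto simp: continuous_map_euclidean_iff\<close>)
  have "continuous_map (torus m) euclidean (\<lambda>x. fan m x i)" if "i < 2 * m + 3" for i
    using that tip chain[of "2 * m + 1"] chain[of "i - 2"] by (auto simp: fan_def)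
  then show ?thesis
    by (auto simp: plane_power_def continuous_map_componentwise fan_def)
qed

section \<open>The left inverse\<close>

text \<open>For \<open>j < m\<close>, \<open>a 3 - a 2\<close> is the first bar of the chain, of
  length \<open>arm m\<close>, and the second factor is unit bar \<open>j\<close>.\<close>

definition direction_cos :: "nat \<Rightarrow> (nat \<Rightarrow> real^2) \<Rightarrow> nat \<Rightarrow> real" where
  "direction_cos m a j = (a 3 - a 2) \<bullet> (a (2 * j + 4) - a (2 * j + 3)) / arm m"

text \<open>The triangle with vertices \<^term>\<open>a 0\<close>, \<^term>\<open>a 1\<close>, \<^term>\<open>a 2\<close> is never degenerate and
  provides an orientation, so the sine of the angle can be read off invariantly under reflections:
  the quotient is the product of two determinants by the absolute value of the second.\<close>

definition direction_sin :: "nat \<Rightarrow> (nat \<Rightarrow> real^2) \<Rightarrow> nat \<Rightarrow> real" where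
  "direction_sin m a j =
    (((a 3 - a 2) \<bullet> (a 1 - a 0)) * ((a (2 * j + 4) - a (2 * j + 3)) \<bullet> (a 2 - a 1))
      - ((a 3 - a 2) \<bullet> (a 2 - a 1)) * ((a (2 * j + 4) - a (2 * j + 3)) \<bullet> (a 1 - a 0)))
    / (arm m * sqrt ((arm m) ^ 4 - ((a 1 - a 0) \<bullet> (a 2 - a 1))\<^sup>2))"

definition directions :: "nat \<Rightarrow> (nat \<Rightarrow> real^2) \<Rightarrow> nat \<Rightarrow> real^2" where
  "directions m a = (\<lambda>j\<in>{..<m}. vector [direction_cos m a j, direction_sin m a j])"

section \<open>Estimates for arbitrary configurations\<close>

lemma configuration_dist:
  assumes "a \<in> configurations (fan_linkage m)"
  shows "dist (a 0) (a 1) = arm m" "dist (a 1) (a 2) = arm m"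
    "k < 2 * m \<Longrightarrow> dist (a (k + 2)) (a (k + 3)) = (if k = 0 then arm m else if even k then 4 else 1)"
    "dist (a (2 * m + 2)) (a 0) = (if m = 0 then arm m else 4)"
    "0 < m \<Longrightarrow> dist (a 2) (a 3) = arm m"
proof -
  have d: "dist (a i) (a (next_index (fan_linkage m) i)) = fan_linkage m ! i" if "i < 2 * m + 3" for i
    using assms that by (simp add: configurations_def)
  show "dist (a 0) (a 1) = arm m" "dist (a 1) (a 2) = arm m"
    using d[of 0] d[of "Suc 0"] by (simp_all add: next_index_fan_linkage nth_fan_linkage)
  show "dist (a (k + 2)) (a (k + 3)) = (if k = 0 then arm m else if even k then 4 else 1)" if "k < 2 * m"
    using d[of "k + 2"] that unfolding next_index_fan_linkage(3)[OF that] by (simp add: nth_fan_linkage)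
  show "dist (a (2 * m + 2)) (a 0) = (if m = 0 then arm m else 4)"
    using d[of "2 * m + 2"] unfolding next_index_fan_linkage(4) by (simp add: nth_fan_linkage)
  show "dist (a 2) (a 3) = arm m" if "0 < m"
    using d[of "0 + 2"] that next_index_fan_linkage(3)[of 0 m] by (simp add: nth_fan_linkage flip: numeral_2_eq_2)
qed

lemma configuration_direction:
  assumes a: "a \<in> configurations (fan_linkage m)" and j: "j < m"
  shows "norm (a 3 - a 2) = arm m" "norm (a (2 * j + 4) - a (2 * j + 3)) = 1"
proof -
  show "norm (a 3 - a 2) = arm m"
    using configuration_dist(5)[OF a] j by (simp add: dist_norm norm_minus_commute)
  have "2 * j + 1 < 2 * m"
    using j by simp
  moreover have "2 * j + 1 + 2 = 2 * j + 3" "2 * j + 1 + 3 = 2 * j + 4"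
    by simp_all
  ultimately have "dist (a (2 * j + 3)) (a (2 * j + 4)) = 1"
    using configuration_dist(3)[OF a, of "2 * j + 1"] by (simp only: if_distrib) simp
  then show "norm (a (2 * j + 4) - a (2 * j + 3)) = 1"
    by (simp add: dist_norm norm_minus_commute)
qed

text \<open>By Lagrange's identity this says that the triangle is nondegenerate, which makes the
  denominator of \<open>direction_sin\<close> nonzero. The side from \<open>a 2\<close> to
  \<open>a 0\<close> is one long bar followed by bars of total length \<open>5 * m\<close>, so its
  length lies strictly between 0 and \<open>2 * arm m\<close>.\<close>

lemma configuration_triangle:
  assumes a: "a \<in> configurations (fan_linkage m)"
  shows "((a 1 - a 0) \<bullet> (a 2 - a 1))\<^sup>2 < (arm m) ^ 4"
proof -
  let ?p = "a 1 - a 0" and ?q = "a 2 - a 1"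
  have l: "arm m > 0"
    by (rule arm_pos)
  have D: "0 < dist (a 2) (a 0) \<and> dist (a 2) (a 0) < 2 * arm m"
  proof (cases m)
    case 0
    then show ?thesis
      using configuration_dist(4)[OF a] l by (simp add: numeral_2_eq_2)
  next
    case (Suc n)
    have b: "dist (a 3) (a (2 * j + 3)) \<le> 5 * real j" if "j \<le> n" for j
      using that
    proof (induction j)
      case (Suc j)
      have j: "2 * j + 1 < 2 * m" "2 * j + 2 < 2 * m"
        using Suc.prems \<open>m = Suc n\<close> by auto
      have eq: "2 * j + 1 + 2 = 2 * j + 3" "2 * j + 1 + 3 = 2 * j + 4" "2 * j + 2 + 2 = 2 * j + 4"
        "2 * j + 2 + 3 = 2 * Suc j + 3"
        by simp_all
      have "dist (a (2 * j + 3)) (a (2 * j + 4)) = 1" "dist (a (2 * j + 4)) (a (2 * Suc j + 3)) = 4"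
        using configuration_dist(3)[OF a j(1)] configuration_dist(3)[OF a j(2)] unfolding eq by simp_all
      moreover have "dist (a 3) (a (2 * j + 3)) \<le> 5 * real j"
        using Suc by simp
      moreover have "dist (a 3) (a (2 * Suc j + 3)) \<le> dist (a 3) (a (2 * j + 3)) +
          dist (a (2 * j + 3)) (a (2 * j + 4)) + dist (a (2 * j + 4)) (a (2 * Suc j + 3))"
        by metric
      ultimately show ?case
        by simp
    qed simp
    have n: "2 * n + 1 < 2 * m"
      using Suc by simp
    have eq: "2 * n + 1 + 2 = 2 * n + 3" "2 * n + 1 + 3 = 2 * m + 2"
      using Suc by simp_all
    have "dist (a (2 * n + 3)) (a (2 * m + 2)) = 1"
      using configuration_dist(3)[OF a n] unfolding eq by simp
    moreover have "dist (a (2 * m + 2)) (a 0) = 4"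
      using configuration_dist(4)[OF a] Suc by simp
    moreover have "dist (a 3) (a 0) \<le> dist (a 3) (a (2 * n + 3)) + dist (a (2 * n + 3)) (a (2 * m + 2))
        + dist (a (2 * m + 2)) (a 0)"
      by metric
    ultimately have "dist (a 3) (a 0) \<le> 5 * real m"
      using b[of n] Suc by simp
    then have "dist (a 3) (a 0) < arm m"
      by (simp add: arm_def)
    moreover have "dist (a 2) (a 3) = arm m"
      using configuration_dist(5)[OF a] Suc by simp
    moreover have "dist (a 2) (a 0) \<le> dist (a 2) (a 3) + dist (a 3) (a 0)"
      "dist (a 2) (a 3) \<le> dist (a 2) (a 0) + dist (a 3) (a 0)"
      by metric+
    ultimately show ?thesis
      by linarith
  qed
  have n: "norm ?p = arm m" "norm ?q = arm m"
    using configuration_dist(1,2)[OF a] by (simp_all add: dist_norm norm_minus_commute)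
  \<comment> \<open>The law of cosines turns the bounds on the third side into bounds on the inner
    product.\<close>
  have "(dist (a 2) (a 0))\<^sup>2 = (norm (?p + ?q))\<^sup>2"
    by (simp add: dist_norm)
  also have "\<dots> = (norm ?p)\<^sup>2 + (norm ?q)\<^sup>2 + 2 * (?p \<bullet> ?q)"
  proof -
    have "(norm (u + v))\<^sup>2 = (norm u)\<^sup>2 + (norm v)\<^sup>2 + 2 * (u \<bullet> v)" for u v :: "real^2"
      unfolding power2_norm_eq_inner by (simp add: inner_add_left inner_add_right inner_commute)
    then show ?thesis .
  qed
  finally have e: "(dist (a 2) (a 0))\<^sup>2 = 2 * (arm m)\<^sup>2 + 2 * (?p \<bullet> ?q)"
    using n by simp
  have "0 < (dist (a 2) (a 0))\<^sup>2"
    using D by simp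
  moreover have "(dist (a 2) (a 0))\<^sup>2 < (2 * arm m)\<^sup>2"
    using D by (intro power_strict_mono) auto
  moreover have "(2 * arm m)\<^sup>2 = 4 * (arm m)\<^sup>2"
    by (simp add: power_mult_distrib)
  ultimately have "- (arm m)\<^sup>2 < ?p \<bullet> ?q" "?p \<bullet> ?q < (arm m)\<^sup>2"
    using e by linarith+
  then have "0 < ((arm m)\<^sup>2 - ?p \<bullet> ?q) * ((arm m)\<^sup>2 + ?p \<bullet> ?q)"
    by (intro mult_pos_pos) auto
  then show ?thesis
    by (simp add: algebra_simps power2_eq_square power4_eq_xxxx)
qed

text \<open>Lagrange's identity for the two bars; the triangle enters only by the sign of its
  determinant, which squares to 1.\<close>

lemma direction_on_circle:
  assumes a: "a \<in> configurations (fan_linkage m)" and j: "j < m"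
  shows "(direction_cos m a j)\<^sup>2 + (direction_sin m a j)\<^sup>2 = 1"
proof -
  define p q f w where "p = a 1 - a 0" and "q = a 2 - a 1" and "f = a 3 - a 2"
    and "w = a (2 * j + 4) - a (2 * j + 3)"
  have l: "arm m > 0"
    by (rule arm_pos)
  have n: "norm f = arm m" "norm w = 1" "norm p = arm m" "norm q = arm m"
    using configuration_direction[OF a j] configuration_dist(1,2)[OF a]
    by (simp_all add: p_def q_def f_def w_def dist_norm norm_minus_commute)
  define r where "r = arm m ^ 4 - (p \<bullet> q)\<^sup>2"
  have r: "r > 0"
    using configuration_triangle[OF a] by (simp add: r_def p_def q_def)
  have "(p \<bullet> q)\<^sup>2 + (det2 p q)\<^sup>2 = arm m ^ 4"
    using inner_det2_square[of p q] n by (simp flip: power_add)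
  then have pq: "(det2 p q)\<^sup>2 = r"
    by (simp add: r_def)
  have fw: "(f \<bullet> w)\<^sup>2 + (det2 f w)\<^sup>2 = (arm m)\<^sup>2"
    using inner_det2_square[of f w] n by simp
  have "direction_sin m a j = det2 f w * det2 p q / (arm m * sqrt r)"
    unfolding direction_sin_def det2_mult_det2 r_def f_def w_def p_def q_def ..
  then have "(direction_sin m a j)\<^sup>2 = (det2 f w)\<^sup>2 * r / ((arm m)\<^sup>2 * r)"
    using r by (simp add: power_mult_distrib power_divide pq)
  then have s: "(direction_sin m a j)\<^sup>2 = (det2 f w)\<^sup>2 / (arm m)\<^sup>2"
    using r by simp
  have c: "(direction_cos m a j)\<^sup>2 = (f \<bullet> w)\<^sup>2 / (arm m)\<^sup>2"
    by (simp add: direction_cos_def f_def w_def power_divide)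
  show ?thesis
    unfolding s c add_divide_distrib[symmetric] fw using l by simp
qed

lemma continuous_map_directions:
  "continuous_map (subtopology (plane_power (2 * m + 3)) (configurations (fan_linkage m))) (torus m) (directions m)"
proof -
  let ?C = "subtopology (plane_power (2 * m + 3)) (configurations (fan_linkage m))"
  have proj: "filterlim (\<lambda>b. b i) (nhds (a i)) (atin ?C a)" if "i < 2 * m + 3" "a \<in> topspace ?C" for i a
  proof -
    have "continuous_map ?C euclidean (\<lambda>b. b i)"
      using that(1) by (auto simp: plane_power_def intro!: continuous_map_from_subtopology continuous_map_product_projection)
    then show ?thesis
      using that(2) by (simp only: continuous_map_euclidean_iff)
  qed
  have "continuous_map ?C euclidean (\<lambda>a. vector [direction_cos m a j, direction_sin m a j] :: real^2)" if j: "j < m" for j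
    unfolding continuous_map_euclidean_iff
  proof (intro ballI tendsto_vec2)
    fix a assume a: "a \<in> topspace ?C"
    have "arm m \<noteq> 0"
      using arm_pos[of m] by simp
    then show "filterlim (\<lambda>b. direction_cos m b j) (nhds (direction_cos m a j)) (atin ?C a)"
      unfolding direction_cos_def using j
      by (intro tendsto_divide tendsto_inner tendsto_diff proj[OF _ a] tendsto_const) auto
    have "a \<in> configurations (fan_linkage m)"
      using a by simp
    then have "arm m * sqrt (arm m ^ 4 - ((a 1 - a 0) \<bullet> (a 2 - a 1))\<^sup>2) \<noteq> 0"
      using configuration_triangle[of a m] arm_pos[of m] by simp
    then show "filterlim (\<lambda>b. direction_sin m b j) (nhds (direction_sin m a j)) (atin ?C a)"
      unfolding direction_sin_def using j
      by (intro tendsto_divide tendsto_mult tendsto_inner tendsto_diff tendsto_real_sqrt tendsto_power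
          proj[OF _ a] tendsto_const) auto
  qed
  then show ?thesis
    by (auto simp: continuous_map_componentwise directions_def continuous_map_in_subtopology norm_eq_1_iff
        direction_on_circle)
qed

text \<open>Polarization expresses the inner product of two differences by squared distances of the
  four points.\<close>

lemma isometry_inner:
  fixes f :: "'a::real_inner \<Rightarrow> 'b::real_inner"
  assumes "\<And>x y. dist (f x) (f y) = dist x y"
  shows "(f a - f b) \<bullet> (f c - f d) = (a - b) \<bullet> (c - d)"
proof -
  have polar: "2 * ((a - b) \<bullet> (c - d)) = (dist a d)\<^sup>2 + (dist b c)\<^sup>2 - (dist a c)\<^sup>2 - (dist b d)\<^sup>2"
    for a b c d :: "'c::real_inner"
    unfolding dist_norm power2_norm_eq_inner by (simp add: inner_diff_left inner_diff_right inner_commute)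
  show ?thesis
    using polar[of "f a" "f b" "f c" "f d"] polar[of a b c d] assms by simp
qed

lemma directions_congruence:
  assumes "(a, b) \<in> congruence (fan_linkage m)"
  shows "directions m a = directions m b"
proof -
  obtain f where f: "plane_isometry f" "\<And>i. i < 2 * m + 3 \<Longrightarrow> b i = f (a i)"
    using assms by (auto simp: congruence_def)
  have inner: "(b i - b j) \<bullet> (b k - b l) = (a i - a j) \<bullet> (a k - a l)"
    if "i < 2 * m + 3" "j < 2 * m + 3" "k < 2 * m + 3" "l < 2 * m + 3" for i j k l
    using that f isometry_inner[of f] by (simp add: plane_isometry_def)
  show ?thesis
    unfolding directions_def
  proof (rule restrict_ext)
    fix j assume "j \<in> {..<m}"
    then show "vector [direction_cos m a j, direction_sin m a j] = (vector [direction_cos m b j, direction_sin m b j] :: real^2)"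
      by (simp add: direction_cos_def direction_sin_def inner)
  qed
qed

text \<open>In a fan the first bar points along the positive first axis and the triangle is
  positively oriented, so cosine and sine are the coordinates of \<open>x j\<close>.\<close>

lemma directions_fan:
  assumes x: "x \<in> topspace (torus m)"
  shows "directions m (fan m x) = x"
proof
  fix j
  show "directions m (fan m x) j = x j"
  proof (cases "j < m")
    case True
    let ?a = "fan m x"
    have unit: "\<And>j. j < m \<Longrightarrow> norm (x j) = 1"
      using torus_norm[OF x] .
    have l: "arm m > 0"
      by (rule arm_pos)
    have a: "?a \<in> configurations (fan_linkage m)"
      by (rule fan_in_configurations[OF unit])
    define p q f w where "p = ?a 1 - ?a 0" and "q = ?a 2 - ?a 1" and "f = ?a 3 - ?a 2"
      and "w = ?a (2 * j + 4) - ?a (2 * j + 3)"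
    have "?a (2 * j + 4) = chain m x (Suc (2 * j + 1))" "?a (2 * j + 3) = chain m x (2 * j + 1)"
      using True fan_nth(3)[of "2 * j + 2" m x] fan_nth(3)[of "2 * j + 1" m x]
      by (simp_all add: numeral_eq_Suc)
    then have w: "w = x j"
      using True chain_step_direction[of j m x] by (simp add: w_def chain_Suc)
    have f: "f = vector [arm m, 0]"
      using True fan_nth(3)[of 1 m x] fan_nth(4)[of m x]
      by (simp add: f_def chain_Suc chain_step_def numeral_eq_Suc)
    have "det2 p q = det2 (foot m x) (tip m x)"
      by (simp add: p_def q_def fan_nth det2_def algebra_simps)
    then have pos: "det2 p q > 0"
      using tip_ineqs(5)[of m x, OF unit] by simp
    have n: "norm p = arm m" "norm q = arm m"
      using configuration_dist(1,2)[OF a] by (simp_all add: p_def q_def dist_norm norm_minus_commute)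
    have "arm m ^ 4 - (p \<bullet> q)\<^sup>2 = (det2 p q)\<^sup>2"
      using inner_det2_square[of p q] n by (simp flip: power_add)
    \<comment> \<open>Positive orientation makes the root the determinant itself and not its
      negative.\<close>
    then have "sqrt (arm m ^ 4 - (p \<bullet> q)\<^sup>2) = det2 p q"
      using pos by simp
    then have "direction_sin m ?a j = det2 f w * det2 p q / (arm m * det2 p q)"
      unfolding direction_sin_def det2_mult_det2 f_def[symmetric] w_def[symmetric] p_def[symmetric] q_def[symmetric]
      by simp
    then have "direction_sin m ?a j = x j $ 2"
      using pos l by (simp add: f w det2_def)
    moreover have "direction_cos m ?a j = x j $ 1"
      using l unfolding direction_cos_def f_def[symmetric] w_def[symmetric] by (simp add: f w inner_2)
    ultimately show ?thesis
      using True by (simp add: directions_def vec_eq_iff forall_2)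
  next
    case False
    then show ?thesis
      using x by (auto simp: directions_def PiE_iff extensional_def)
  qed
qed

section \<open>The torus inside the closure of the simple classes\<close>

theorem theorem3p1:
  fixes m :: nat
  shows "\<exists>P. linkage P \<and>
    (\<forall>k::int. 0 \<le> k \<and> k \<le> int m \<longrightarrow> \<not> trivial_group (homology_group k (closure_simple_space P)))"
proof (intro exI conjI allI impI)
  let ?P = "fan_linkage m"
  let ?C = "subtopology (plane_power (length ?P)) (configurations ?P)"
  let ?cl = "\<lambda>a. congruence ?P `` {a}"
  show "linkage ?P"
    by (rule linkage_fan_linkage)
  fix k :: int
  assume k: "0 \<le> k \<and> k \<le> int m"
  have conf: "fan m x \<in> configurations ?P" if "x \<in> topspace (torus m)" for x
    using fan_in_configurations torus_norm[OF that] by blast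
  have q: "quotient_map ?C (configuration_space ?P) ?cl"
    unfolding configuration_space_def by (rule quotient_map_quotient_topology)
  have C: "topspace ?C = configurations ?P"
    by (auto simp: configurations_def)
  have "continuous_map (torus m) ?C (fan m)"
    using continuous_map_fan[of m] conf by (auto simp: continuous_map_in_subtopology simp del: topspace_product_topology)
  then have s: "continuous_map (torus m) (configuration_space ?P) (\<lambda>x. ?cl (fan m x))"
    using continuous_map_compose[OF _ quotient_imp_continuous_map[OF q]] by (simp add: o_def)
  \<comment> \<open>Generic points map to simple classes and are dense, so continuity sends the
    whole torus into the closure.\<close>
  have "(\<lambda>x. ?cl (fan m x)) ` topspace (torus m) \<subseteq> configuration_space ?P closure_of simple_classes ?P"
  proof -
    let ?D = "{x \<in> topspace (torus m). \<forall>j<m. x j $ 2 \<noteq> 0}"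
    have "?cl (fan m x) \<in> simple_classes ?P" if "x \<in> ?D" for x
      using that conf[of x] self_intersection_free_fan[of m x] torus_norm[of x m]
      unfolding simple_classes_def by (intro quotientI) blast
    then have "(\<lambda>x. ?cl (fan m x)) ` ?D \<subseteq> simple_classes ?P"
      by blast
    then have "configuration_space ?P closure_of ((\<lambda>x. ?cl (fan m x)) ` ?D)
        \<subseteq> configuration_space ?P closure_of simple_classes ?P"
      by (rule closure_of_mono)
    then show ?thesis
      using continuous_map_image_closure_subset[OF s, of ?D] unfolding torus_closure_of_generic by blast
  qed
  then have s': "continuous_map (torus m) (closure_simple_space ?P) (\<lambda>x. ?cl (fan m x))"
    using s unfolding closure_simple_space_def continuous_map_in_subtopology by blast
  \<comment> \<open>Any representative gives the same value, since \<open>directions\<close> is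
    constant on congruence classes.\<close>
  define g where "g c = directions m (SOME a. a \<in> c)" for c
  have g: "g (?cl a) = directions m a" if "a \<in> configurations ?P" for a
  proof -
    have "a \<in> ?cl a"
      using that equiv_class_self[OF equiv_congruence] by blast
    then have "(SOME b. b \<in> ?cl a) \<in> ?cl a"
      by (rule someI[of "\<lambda>b. b \<in> ?cl a"])
    then show ?thesis
      unfolding g_def using directions_congruence by (metis Image_singleton_iff)
  qed
  \<comment> \<open>By the universal property of the quotient, continuity of \<open>g\<close> is
    checked on configurations, where \<open>g\<close> becomes \<open>directions m\<close>.\<close>
  have "continuous_map ?C (torus m) (g \<circ> ?cl)"
  proof (rule continuous_map_eq)
    show "continuous_map ?C (torus m) (directions m)"
      using continuous_map_directions[of m] by (simp only: length_fan_linkage)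
    show "directions m a = (g \<circ> ?cl) a" if "a \<in> topspace ?C" for a
      using g[of a] that unfolding C by simp
  qed
  then have "continuous_map (configuration_space ?P) (torus m) g"
    by (rule continuous_compose_quotient_map[OF q])
  then have g': "continuous_map (closure_simple_space ?P) (torus m) g"
    unfolding closure_simple_space_def by (rule continuous_map_from_subtopology)
  have gs: "g (?cl (fan m x)) = x" if "x \<in> topspace (torus m)" for x
    using g[OF conf[OF that]] directions_fan[OF that] by simp
  have "\<not> trivial_group (homology_group k (torus m))"
    using nontrivial_homology_group_torus[of "nat k" m] k by (simp add: nat_le_iff)
  then show "\<not> trivial_group (homology_group k (closure_simple_space ?P))"
    using gs by (intro nontrivial_homology_group_section[OF s' g'])
qed

end
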